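(* Let $\mathcal{C}$ be a category with pullbacks of split epimorphisms along split epimorphisms and finite products. Then the following conditions are equivalent: (1) The category $\mathcal{C}$ is naturally Mal'tsev. (2) The forgetful functor $\mathbf{Grpd}(\mathcal{C})\to\mathbf{RG}(\mathcal{C})$ has a section. (3) The forgetful functor $\mathbf{Cat}(\mathcal{C})\to\mathbf{RG}(\mathcal{C})$ has a section. (4) Every relation in $\mathcal{C}$ is compatible with the class of all spans (i.e. is compatible with every span). (5) Every dikite diagram in $\mathcal{C}$ is admissible. (6) Every span in $\mathcal{C}$ has a canonical pregroupoid structure.
   Context: A span $(D,d,c)$ is a pair of morphisms $d\colon D\to D_0$, $c\colon D\to D_1$ both admitting kernel pairs, $(d_1,d_2\colon D(d)\to D)$ and $(c_1,c_2\colon D(c)\to D)$. A relation is a jointly monic span (legs admitting kernel pairs). $\mathcal{C}$ is naturally Mal'tsev if it has binary products and every object $X$ is equipped with a morphism $p_X\colon X\times X\times X\to X$ such that $f p_X=p_Y(f\times f\times f)$ for every $f\colon X\to Y$, and $p_X\langle x,y,y\rangle=x$, $p_X\langle y,y,z\rangle=z$ for all parallel $x,y,z\colon S\to X$. Reflexive graph: $(C_1,C_0,d,e,c)$ with $d,c\colon C_1\to C_0$, $e\colon C_0\to C_1$, $de=1_{C_0}=ce$. Internal category: a reflexive graph with $m\colon C_1\times_{C_0}C_1\to C_1$ (pullback with $d\pi_1=c\pi_2$) such that $dm=d\pi_2$, $cm=c\pi_1$, $m\langle1,ed\rangle=1=m\langle ec,1\rangle$, and $m$ associative. Internal groupoid: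 an internal category with $i\colon C_1\to C_1$ such that $m\langle1,i\rangle=ec$, $m\langle i,1\rangle=ed$ (in particular $di=c$, $ci=d$). $\mathbf{RG}(\mathcal{C})$, $\mathbf{Cat}(\mathcal{C})$, $\mathbf{Grpd}(\mathcal{C})$ are the corresponding categories with structure-preserving morphisms. A section of a functor $F$ is a functor $S$ with $FS$ the identity. Compatibility: a span $(E,p_1,p_2)$, $p_1\colon E\to A$, $p_2\colon E\to C$, is compatible with a span $(D,d,c)$ if for all $\alpha\colon A\to D$, $\gamma\colon C\to D$, $e_1\colon A\to E$, $e_2\colon C\to E$ with $p_1e_1=1_A$, $p_2e_2=1_C$, $(e_1p_1)(e_2p_2)=(e_2p_2)(e_1p_1)$, $\alpha p_1(e_2p_2)=\gamma p_2(e_1p_1)$, $d\alpha p_1=d\alpha p_1(e_2p_2)$, $c\gamma p_2=c\gamma p_2(e_1p_1)$, there is a unique $m\colon E\to D$ with $me_1=\alpha$, $me_2=\gamma$, $dm=d\gamma p_2$, $cm=c\alpha p_1$. Dikite diagram with direction $(D,d,c)$ (a span): morphisms $f\colon A\to B$, $r\colon B\to A$, $g\colon C\to B$, $s\colon B\to C$, $\alpha\colon A\to D$, $\beta\colon B\to D$, $\gamma\colon C\to D$ with $fr=1_B=gs$, $\alpha r=\beta=\gamma s$, $d\alpha=d\beta f$, $c\beta g=c\gamma$. It is admissible if there is a unique $m\colon A\times_BC\to D$ (pullback of $f$ and $g$, projections $\pi_1,\pi_2$) with $m\langle1_A,sf\rangle=\alpha$, $m\langle rg,1_C\rangle=\gamma$,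 $dm=d\gamma\pi_2$, $cm=c\alpha\pi_1$. Let $D(d,c)$ be the pullback of $d_2\colon D(d)\to D$ and $c_1\colon D(c)\to D$; it classifies triples $\langle x,y,z\rangle$ of morphisms into $D$ with $dx=dy$, $cy=cz$. A pregroupoid structure on $(D,d,c)$ is $p\colon D(d,c)\to D$ with $dp\langle x,y,z\rangle=dz$, $cp\langle x,y,z\rangle=cx$, $p\langle x,y,y\rangle=x$, $p\langle y,y,z\rangle=z$. "Every span has a canonical pregroupoid structure" means: every span $(D,d,c)$ is equipped with a unique pregroupoid structure $p_D$, and these are natural, i.e. whenever $f\colon D\to D'$, $f_0$, $f_1$ satisfy $d'f=f_0d$, $c'f=f_1c$, one has $f p_D\langle x,y,z\rangle=p_{D'}\langle fx,fy,fz\rangle$ for all such triples; in particular each $p_D$ is associative: $p_D\langle u,v,p_D\langle x,y,z\rangle\rangle=p_D\langle p_D\langle u,v,x\rangle,y,z\rangle$ whenever $du=dv$, $cv=cx$, $dx=dy$, $cy=cz$. *)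

theory Defs
  imports Main
begin

record ('o, 'a) cat_data =
  Ob :: "'o set"
  Ar :: "'a set"
  src :: "'a \<Rightarrow> 'o"
  tgt :: "'a \<Rightarrow> 'o"
  ident :: "'o \<Rightarrow> 'a" ("\<one>\<index>")
  cmp :: "'a \<Rightarrow> 'a \<Rightarrow> 'a" (infixr "\<cdot>\<index>" 70)

definition hom :: "('o, 'a) cat_data \<Rightarrow> 'o \<Rightarrow> 'o \<Rightarrow> 'a set" where
  "hom C X Y = {f \<in> Ar C. src C f = X \<and> tgt C f = Y}"

locale category =
  fixes C :: "('o, 'a) cat_data" (structure)
  assumes src_Ob: "f \<in> Ar C \<Longrightarrow> src C f \<in> Ob C"
    and tgt_Ob: "f \<in> Ar C \<Longrightarrow> tgt C f \<in> Ob C"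
    and ident_hom: "X \<in> Ob C \<Longrightarrow> \<one> X \<in> hom C X X"
    and cmp_hom: "\<lbrakk>f \<in> hom C X Y; g \<in> hom C Y Z\<rbrakk> \<Longrightarrow> g \<cdot> f \<in> hom C X Z"
    and cmp_ident: "f \<in> hom C X Y \<Longrightarrow> f \<cdot> \<one> X = f"
    and ident_cmp: "f \<in> hom C X Y \<Longrightarrow> \<one> Y \<cdot> f = f"
    and cmp_assoc: "\<lbrakk>f \<in> hom C W X; g \<in> hom C X Y; h \<in> hom C Y Z\<rbrakk>
      \<Longrightarrow> (h \<cdot> g) \<cdot> f = h \<cdot> (g \<cdot> f)"

locale cat_functor = A: category A + B: category B
  for A :: "('o1, 'a1) cat_data" and B :: "('o2, 'a2) cat_data" +
  fixes Fo :: "'o1 \<Rightarrow> 'o2" and Fa :: "'a1 \<Rightarrow> 'a2"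
  assumes Fo_Ob: "X \<in> Ob A \<Longrightarrow> Fo X \<in> Ob B"
    and Fa_hom: "f \<in> hom A X Y \<Longrightarrow> Fa f \<in> hom B (Fo X) (Fo Y)"
    and Fa_ident: "X \<in> Ob A \<Longrightarrow> Fa (ident A X) = ident B (Fo X)"
    and Fa_cmp: "\<lbrakk>f \<in> hom A X Y; g \<in> hom A Y Z\<rbrakk>
      \<Longrightarrow> Fa (cmp A g f) = cmp B (Fa g) (Fa f)"

definition has_section ::
  "('o1, 'a1) cat_data \<Rightarrow> ('o2, 'a2) cat_data \<Rightarrow> ('o1 \<Rightarrow> 'o2) \<Rightarrow> ('a1 \<Rightarrow> 'a2) \<Rightarrow> bool" where
  "has_section A B Fo Fa \<longleftrightarrow>
     (\<exists>So Sa. cat_functor B A So Sa \<and>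
        (\<forall>X\<in>Ob B. Fo (So X) = X) \<and> (\<forall>f\<in>Ar B. Fa (Sa f) = f))"

record ('o, 'a) rgraph =
  C1 :: 'o
  C0 :: 'o
  gd :: 'a
  ge :: 'a
  gc :: 'a

record ('o, 'a) icat = "('o, 'a) rgraph" +
  gm :: 'a

record ('o, 'a) igrpd = "('o, 'a) icat" +
  gi :: 'a

text \<open>A morphism carries its source and target structure, so that the categories below
  have well-defined source and target maps.\<close>

datatype ('g, 'a) gmor = GMor (gsrc: 'g) (gtgt: 'g) (mor1: 'a) (mor0: 'a)

definition forget_ar :: "('g \<Rightarrow> 'h) \<Rightarrow> ('g, 'a) gmor \<Rightarrow> ('h, 'a) gmor" where
  "forget_ar U f = GMor (U (gsrc f)) (U (gtgt f)) (mor1 f) (mor0 f)"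

context category
begin

definition is_pullback :: "'a \<Rightarrow> 'a \<Rightarrow> 'a \<Rightarrow> 'a \<Rightarrow> bool" where
  "is_pullback f g p q \<longleftrightarrow>
     f \<in> Ar C \<and> g \<in> Ar C \<and> tgt C f = tgt C g \<and>
     p \<in> hom C (src C p) (src C f) \<and> q \<in> hom C (src C p) (src C g) \<and> f \<cdot> p = g \<cdot> q \<and>
     (\<forall>S. \<forall>u\<in>hom C S (src C f). \<forall>v\<in>hom C S (src C g). f \<cdot> u = g \<cdot> v \<longrightarrow>
        (\<exists>!w. w \<in> hom C S (src C p) \<and> p \<cdot> w = u \<and> q \<cdot> w = v))"

definition has_pullback :: "'a \<Rightarrow> 'a \<Rightarrow> bool" where
  "has_pullback f g \<longleftrightarrow> (\<exists>p q. is_pullback f g p q)"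

text \<open>A fixed choice of pullback, meaningful whenever a pullback exists.\<close>

definition pb :: "'a \<Rightarrow> 'a \<Rightarrow> 'a \<times> 'a" where
  "pb f g = (SOME pq. is_pullback f g (fst pq) (snd pq))"

definition pb1 :: "'a \<Rightarrow> 'a \<Rightarrow> 'a" where "pb1 f g = fst (pb f g)"

definition pb2 :: "'a \<Rightarrow> 'a \<Rightarrow> 'a" where "pb2 f g = snd (pb f g)"

definition pb_ob :: "'a \<Rightarrow> 'a \<Rightarrow> 'o" where "pb_ob f g = src C (pb1 f g)"

definition pb_pair :: "'a \<Rightarrow> 'a \<Rightarrow> 'a \<Rightarrow> 'a \<Rightarrow> 'a" where
  "pb_pair f g u v =
     (THE w. w \<in> hom C (src C u) (pb_ob f g) \<and> pb1 f g \<cdot> w = u \<and> pb2 f g \<cdot> w = v)"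

definition split_epi :: "'a \<Rightarrow> bool" where
  "split_epi f \<longleftrightarrow> f \<in> Ar C \<and> (\<exists>s\<in>hom C (tgt C f) (src C f). f \<cdot> s = \<one> (tgt C f))"

definition has_split_epi_pullbacks :: bool where
  "has_split_epi_pullbacks \<longleftrightarrow>
     (\<forall>f g. split_epi f \<and> split_epi g \<and> tgt C f = tgt C g \<longrightarrow> has_pullback f g)"

definition is_product :: "'o \<Rightarrow> 'o \<Rightarrow> 'a \<Rightarrow> 'a \<Rightarrow> bool" where
  "is_product X Y p q \<longleftrightarrow>
     p \<in> hom C (src C p) X \<and> q \<in> hom C (src C p) Y \<and>
     (\<forall>S. \<forall>u\<in>hom C S X. \<forall>v\<in>hom C S Y.
        (\<exists>!w. w \<in> hom C S (src C p) \<and> p \<cdot> w = u \<and> q \<cdot> w = v))"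

definition has_binary_products :: bool where
  "has_binary_products \<longleftrightarrow> (\<forall>X\<in>Ob C. \<forall>Y\<in>Ob C. \<exists>p q. is_product X Y p q)"

definition is_terminal :: "'o \<Rightarrow> bool" where
  "is_terminal T \<longleftrightarrow> T \<in> Ob C \<and> (\<forall>X\<in>Ob C. \<exists>!t. t \<in> hom C X T)"

definition has_finite_products :: bool where
  "has_finite_products \<longleftrightarrow> (\<exists>T. is_terminal T) \<and> has_binary_products"

definition prod :: "'o \<Rightarrow> 'o \<Rightarrow> 'a \<times> 'a" where
  "prod X Y = (SOME pq. is_product X Y (fst pq) (snd pq))"

definition pr1 :: "'o \<Rightarrow> 'o \<Rightarrow> 'a" where "pr1 X Y = fst (prod X Y)"

definition pr2 :: "'o \<Rightarrow> 'o \<Rightarrow> 'a" where "pr2 X Y = snd (prod X Y)"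

definition prod_ob :: "'o \<Rightarrow> 'o \<Rightarrow> 'o" where "prod_ob X Y = src C (pr1 X Y)"

definition prod_pair :: "'o \<Rightarrow> 'o \<Rightarrow> 'a \<Rightarrow> 'a \<Rightarrow> 'a" where
  "prod_pair X Y u v =
     (THE w. w \<in> hom C (src C u) (prod_ob X Y) \<and> pr1 X Y \<cdot> w = u \<and> pr2 X Y \<cdot> w = v)"

definition cube :: "'o \<Rightarrow> 'o" where
  "cube X = prod_ob (prod_ob X X) X"

definition triple :: "'o \<Rightarrow> 'a \<Rightarrow> 'a \<Rightarrow> 'a \<Rightarrow> 'a" where
  "triple X x y z = prod_pair (prod_ob X X) X (prod_pair X X x y) z"

text \<open>The morphism \<open>f \<times> f \<times> f\<close>, where \<open>f\<close> goes from \<open>X\<close> to \<open>Y\<close>.\<close>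

definition cube_map :: "'o \<Rightarrow> 'o \<Rightarrow> 'a \<Rightarrow> 'a" where
  "cube_map X Y f = triple Y
     (f \<cdot> (pr1 X X \<cdot> pr1 (prod_ob X X) X))
     (f \<cdot> (pr2 X X \<cdot> pr1 (prod_ob X X) X))
     (f \<cdot> pr2 (prod_ob X X) X)"

definition naturally_maltsev :: bool where
  "naturally_maltsev \<longleftrightarrow> has_binary_products \<and>
     (\<exists>p. (\<forall>X\<in>Ob C. p X \<in> hom C (cube X) X) \<and>
          (\<forall>X Y. \<forall>f\<in>hom C X Y. f \<cdot> p X = p Y \<cdot> cube_map X Y f) \<and>
          (\<forall>S X. \<forall>x\<in>hom C S X. \<forall>y\<in>hom C S X. p X \<cdot> triple X x y y = x) \<and>
          (\<forall>S X. \<forall>y\<in>hom C S X. \<forall>z\<in>hom C S X. p X \<cdot> triple X y y z = z))"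

definition is_rgraph :: "('o, 'a, 'z) rgraph_scheme \<Rightarrow> bool" where
  "is_rgraph G \<longleftrightarrow>
     gd G \<in> hom C (C1 G) (C0 G) \<and> gc G \<in> hom C (C1 G) (C0 G) \<and> ge G \<in> hom C (C0 G) (C1 G) \<and>
     gd G \<cdot> ge G = \<one> (C0 G) \<and> gc G \<cdot> ge G = \<one> (C0 G)"

text \<open>The pairing into the object of composable pairs; associativity of the
  multiplication is stated on generalised composable triples.\<close>

abbreviation cpair :: "('o, 'a, 'z) rgraph_scheme \<Rightarrow> 'a \<Rightarrow> 'a \<Rightarrow> 'a" where
  "cpair G u v \<equiv> pb_pair (gd G) (gc G) u v"

definition is_icat :: "('o, 'a, 'z) icat_scheme \<Rightarrow> bool" where
  "is_icat G \<longleftrightarrow> is_rgraph G \<and>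
     gm G \<in> hom C (pb_ob (gd G) (gc G)) (C1 G) \<and>
     gd G \<cdot> gm G = gd G \<cdot> pb2 (gd G) (gc G) \<and>
     gc G \<cdot> gm G = gc G \<cdot> pb1 (gd G) (gc G) \<and>
     gm G \<cdot> cpair G (\<one> (C1 G)) (ge G \<cdot> gd G) = \<one> (C1 G) \<and>
     gm G \<cdot> cpair G (ge G \<cdot> gc G) (\<one> (C1 G)) = \<one> (C1 G) \<and>
     (\<forall>S. \<forall>x\<in>hom C S (C1 G). \<forall>y\<in>hom C S (C1 G). \<forall>z\<in>hom C S (C1 G).
        gd G \<cdot> x = gc G \<cdot> y \<and> gd G \<cdot> y = gc G \<cdot> z \<longrightarrow>
        gm G \<cdot> cpair G (gm G \<cdot> cpair G x y) z = gm G \<cdot> cpair G x (gm G \<cdot> cpair G y z))"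

definition is_igrpd :: "('o, 'a, 'z) igrpd_scheme \<Rightarrow> bool" where
  "is_igrpd G \<longleftrightarrow> is_icat G \<and>
     gi G \<in> hom C (C1 G) (C1 G) \<and> gd G \<cdot> gi G = gc G \<and> gc G \<cdot> gi G = gd G \<and>
     gm G \<cdot> cpair G (\<one> (C1 G)) (gi G) = ge G \<cdot> gc G \<and>
     gm G \<cdot> cpair G (gi G) (\<one> (C1 G)) = ge G \<cdot> gd G"

definition is_rg_mor :: "(('o, 'a, 'z) rgraph_scheme, 'a) gmor \<Rightarrow> bool" where
  "is_rg_mor f \<longleftrightarrow> is_rgraph (gsrc f) \<and> is_rgraph (gtgt f) \<and>
     mor1 f \<in> hom C (C1 (gsrc f)) (C1 (gtgt f)) \<and>
     mor0 f \<in> hom C (C0 (gsrc f)) (C0 (gtgt f)) \<and>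
     gd (gtgt f) \<cdot> mor1 f = mor0 f \<cdot> gd (gsrc f) \<and>
     gc (gtgt f) \<cdot> mor1 f = mor0 f \<cdot> gc (gsrc f) \<and>
     mor1 f \<cdot> ge (gsrc f) = ge (gtgt f) \<cdot> mor0 f"

definition is_icat_mor :: "(('o, 'a, 'z) icat_scheme, 'a) gmor \<Rightarrow> bool" where
  "is_icat_mor f \<longleftrightarrow> is_rg_mor f \<and> is_icat (gsrc f) \<and> is_icat (gtgt f) \<and>
     mor1 f \<cdot> gm (gsrc f) =
       gm (gtgt f) \<cdot> cpair (gtgt f) (mor1 f \<cdot> pb1 (gd (gsrc f)) (gc (gsrc f)))
                                    (mor1 f \<cdot> pb2 (gd (gsrc f)) (gc (gsrc f)))"

definition is_igrpd_mor :: "(('o, 'a, 'z) igrpd_scheme, 'a) gmor \<Rightarrow> bool" where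
  "is_igrpd_mor f \<longleftrightarrow> is_icat_mor f \<and> is_igrpd (gsrc f) \<and> is_igrpd (gtgt f) \<and>
     mor1 f \<cdot> gi (gsrc f) = gi (gtgt f) \<cdot> mor1 f"

definition structure_cat ::
  "(('o, 'a, 'z) rgraph_scheme \<Rightarrow> bool) \<Rightarrow> ((('o, 'a, 'z) rgraph_scheme, 'a) gmor \<Rightarrow> bool)
   \<Rightarrow> (('o, 'a, 'z) rgraph_scheme, (('o, 'a, 'z) rgraph_scheme, 'a) gmor) cat_data" where
  "structure_cat P Q =
     \<lparr>Ob = Collect P, Ar = Collect Q, src = gsrc, tgt = gtgt,
      ident = (\<lambda>G. GMor G G (\<one> (C1 G)) (\<one> (C0 G))),
      cmp = (\<lambda>g f. GMor (gsrc f) (gtgt g) (mor1 g \<cdot> mor1 f) (mor0 g \<cdot> mor0 f))\<rparr>"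

definition RG :: "(('o, 'a) rgraph, (('o, 'a) rgraph, 'a) gmor) cat_data" where
  "RG = structure_cat is_rgraph is_rg_mor"

definition Cat :: "(('o, 'a) icat, (('o, 'a) icat, 'a) gmor) cat_data" where
  "Cat = structure_cat is_icat is_icat_mor"

definition Grpd :: "(('o, 'a) igrpd, (('o, 'a) igrpd, 'a) gmor) cat_data" where
  "Grpd = structure_cat is_igrpd is_igrpd_mor"

text \<open>The forgetful functors to reflexive graphs act on objects by record truncation.\<close>

definition Grpd_RG_has_section :: bool where
  "Grpd_RG_has_section \<longleftrightarrow> has_section Grpd RG rgraph.truncate (forget_ar rgraph.truncate)"

definition Cat_RG_has_section :: bool where
  "Cat_RG_has_section \<longleftrightarrow> has_section Cat RG rgraph.truncate (forget_ar rgraph.truncate)"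

definition is_span :: "'a \<Rightarrow> 'a \<Rightarrow> bool" where
  "is_span d c \<longleftrightarrow> d \<in> Ar C \<and> c \<in> Ar C \<and> src C d = src C c \<and> has_pullback d d \<and> has_pullback c c"

definition is_relation :: "'a \<Rightarrow> 'a \<Rightarrow> bool" where
  "is_relation d c \<longleftrightarrow> is_span d c \<and>
     (\<forall>S. \<forall>x\<in>hom C S (src C d). \<forall>y\<in>hom C S (src C d).
        d \<cdot> x = d \<cdot> y \<and> c \<cdot> x = c \<cdot> y \<longrightarrow> x = y)"

definition compatible :: "'a \<Rightarrow> 'a \<Rightarrow> 'a \<Rightarrow> 'a \<Rightarrow> bool" where
  "compatible p1 p2 d c \<longleftrightarrow>
     (\<forall>\<alpha>\<in>hom C (tgt C p1) (src C d). \<forall>\<gamma>\<in>hom C (tgt C p2) (src C d).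
      \<forall>e1\<in>hom C (tgt C p1) (src C p1). \<forall>e2\<in>hom C (tgt C p2) (src C p1).
        p1 \<cdot> e1 = \<one> (tgt C p1) \<and> p2 \<cdot> e2 = \<one> (tgt C p2) \<and>
        (e1 \<cdot> p1) \<cdot> (e2 \<cdot> p2) = (e2 \<cdot> p2) \<cdot> (e1 \<cdot> p1) \<and>
        (\<alpha> \<cdot> p1) \<cdot> (e2 \<cdot> p2) = (\<gamma> \<cdot> p2) \<cdot> (e1 \<cdot> p1) \<and>
        d \<cdot> \<alpha> \<cdot> p1 = (d \<cdot> \<alpha> \<cdot> p1) \<cdot> (e2 \<cdot> p2) \<and>
        c \<cdot> \<gamma> \<cdot> p2 = (c \<cdot> \<gamma> \<cdot> p2) \<cdot> (e1 \<cdot> p1) \<longrightarrow>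
        (\<exists>!m. m \<in> hom C (src C p1) (src C d) \<and> m \<cdot> e1 = \<alpha> \<and> m \<cdot> e2 = \<gamma> \<and>
              d \<cdot> m = d \<cdot> \<gamma> \<cdot> p2 \<and> c \<cdot> m = c \<cdot> \<alpha> \<cdot> p1))"

definition relations_compatible_with_spans :: bool where
  "relations_compatible_with_spans \<longleftrightarrow>
     (\<forall>p1 p2 d c. is_relation p1 p2 \<and> is_span d c \<longrightarrow> compatible p1 p2 d c)"

definition is_dikite ::
  "'a \<Rightarrow> 'a \<Rightarrow> 'a \<Rightarrow> 'a \<Rightarrow> 'a \<Rightarrow> 'a \<Rightarrow> 'a \<Rightarrow> 'a \<Rightarrow> 'a \<Rightarrow> bool" where
  "is_dikite f r g s \<alpha> \<beta> \<gamma> d c \<longleftrightarrow> is_span d c \<and>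
     f \<in> Ar C \<and> g \<in> hom C (src C g) (tgt C f) \<and>
     r \<in> hom C (tgt C f) (src C f) \<and> s \<in> hom C (tgt C f) (src C g) \<and>
     \<alpha> \<in> hom C (src C f) (src C d) \<and> \<beta> \<in> hom C (tgt C f) (src C d) \<and>
     \<gamma> \<in> hom C (src C g) (src C d) \<and>
     f \<cdot> r = \<one> (tgt C f) \<and> g \<cdot> s = \<one> (tgt C f) \<and>
     \<alpha> \<cdot> r = \<beta> \<and> \<gamma> \<cdot> s = \<beta> \<and>
     d \<cdot> \<alpha> = d \<cdot> \<beta> \<cdot> f \<and> c \<cdot> \<beta> \<cdot> g = c \<cdot> \<gamma>"

definition admissible ::
  "'a \<Rightarrow> 'a \<Rightarrow> 'a \<Rightarrow> 'a \<Rightarrow> 'a \<Rightarrow> 'a \<Rightarrow> 'a \<Rightarrow> 'a \<Rightarrow> bool" where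
  "admissible f r g s \<alpha> \<gamma> d c \<longleftrightarrow>
     (\<exists>!m. m \<in> hom C (pb_ob f g) (src C d) \<and>
        m \<cdot> pb_pair f g (\<one> (src C f)) (s \<cdot> f) = \<alpha> \<and>
        m \<cdot> pb_pair f g (r \<cdot> g) (\<one> (src C g)) = \<gamma> \<and>
        d \<cdot> m = d \<cdot> \<gamma> \<cdot> pb2 f g \<and> c \<cdot> m = c \<cdot> \<alpha> \<cdot> pb1 f g)"

definition dikites_admissible :: bool where
  "dikites_admissible \<longleftrightarrow>
     (\<forall>f r g s \<alpha> \<beta> \<gamma> d c. is_dikite f r g s \<alpha> \<beta> \<gamma> d c \<longrightarrow> admissible f r g s \<alpha> \<gamma> d c)"

text \<open>The pullback of the second kernel pair projection of \<open>d\<close> and the first one of \<open>c\<close>.\<close>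

definition span_ob :: "'a \<Rightarrow> 'a \<Rightarrow> 'o" where
  "span_ob d c = pb_ob (pb2 d d) (pb1 c c)"

definition span_triple :: "'a \<Rightarrow> 'a \<Rightarrow> 'a \<Rightarrow> 'a \<Rightarrow> 'a \<Rightarrow> 'a" where
  "span_triple d c x y z = pb_pair (pb2 d d) (pb1 c c) (pb_pair d d x y) (pb_pair c c y z)"

definition is_pregroupoid :: "'a \<Rightarrow> 'a \<Rightarrow> 'a \<Rightarrow> bool" where
  "is_pregroupoid d c p \<longleftrightarrow> p \<in> hom C (span_ob d c) (src C d) \<and>
     (\<forall>S. \<forall>x\<in>hom C S (src C d). \<forall>y\<in>hom C S (src C d). \<forall>z\<in>hom C S (src C d).
        d \<cdot> x = d \<cdot> y \<and> c \<cdot> y = c \<cdot> z \<longrightarrow>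
        d \<cdot> p \<cdot> span_triple d c x y z = d \<cdot> z \<and> c \<cdot> p \<cdot> span_triple d c x y z = c \<cdot> x) \<and>
     (\<forall>S. \<forall>x\<in>hom C S (src C d). \<forall>y\<in>hom C S (src C d).
        d \<cdot> x = d \<cdot> y \<longrightarrow> p \<cdot> span_triple d c x y y = x) \<and>
     (\<forall>S. \<forall>y\<in>hom C S (src C d). \<forall>z\<in>hom C S (src C d).
        c \<cdot> y = c \<cdot> z \<longrightarrow> p \<cdot> span_triple d c y y z = z)"

definition natural_pregroupoids :: "('a \<Rightarrow> 'a \<Rightarrow> 'a) \<Rightarrow> bool" where
  "natural_pregroupoids p \<longleftrightarrow>
     (\<forall>d c d' c'. is_span d c \<and> is_span d' c' \<longrightarrow>
       (\<forall>f\<in>hom C (src C d) (src C d'). \<forall>f0\<in>hom C (tgt C d) (tgt C d').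
        \<forall>f1\<in>hom C (tgt C c) (tgt C c').
          d' \<cdot> f = f0 \<cdot> d \<and> c' \<cdot> f = f1 \<cdot> c \<longrightarrow>
          (\<forall>S. \<forall>x\<in>hom C S (src C d). \<forall>y\<in>hom C S (src C d). \<forall>z\<in>hom C S (src C d).
             d \<cdot> x = d \<cdot> y \<and> c \<cdot> y = c \<cdot> z \<longrightarrow>
             f \<cdot> p d c \<cdot> span_triple d c x y z
               = p d' c' \<cdot> span_triple d' c' (f \<cdot> x) (f \<cdot> y) (f \<cdot> z))))"

definition canonical_pregroupoids :: "('a \<Rightarrow> 'a \<Rightarrow> 'a) \<Rightarrow> bool" where
  "canonical_pregroupoids p \<longleftrightarrow>
     (\<forall>d c. is_span d c \<longrightarrow>
        is_pregroupoid d c (p d c) \<and> (\<forall>q. is_pregroupoid d c q \<longrightarrow> q = p d c)) \<and>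
     natural_pregroupoids p"

definition spans_have_canonical_pregroupoids :: bool where
  "spans_have_canonical_pregroupoids \<longleftrightarrow> (\<exists>p. canonical_pregroupoids p)"

lemma homD: "f \<in> hom C X Y \<Longrightarrow> f \<in> Ar C \<and> src C f = X \<and> tgt C f = Y"
  by (simp add: hom_def)

lemma ArD: "f \<in> Ar C \<Longrightarrow> f \<in> hom C (src C f) (tgt C f)"
  by (simp add: hom_def)

lemma hom_Ob: "f \<in> hom C X Y \<Longrightarrow> X \<in> Ob C \<and> Y \<in> Ob C"
  unfolding hom_def using src_Ob[of f] tgt_Ob[of f] by auto

lemma pb_props: "has_pullback f g \<Longrightarrow> is_pullback f g (pb1 f g) (pb2 f g)"
  unfolding has_pullback_def pb1_def pb2_def pb_def
  by (rule someI_ex[where P="\<lambda>pq. is_pullback f g (fst pq) (snd pq)"]) simp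

lemma pb_homs:
  assumes "has_pullback f g"
  shows "f \<in> hom C (src C f) (tgt C f)" "g \<in> hom C (src C g) (tgt C f)" "tgt C f = tgt C g"
    "pb1 f g \<in> hom C (pb_ob f g) (src C f)" "pb2 f g \<in> hom C (pb_ob f g) (src C g)"
    "f \<cdot> pb1 f g = g \<cdot> pb2 f g"
  using pb_props[OF assms] unfolding is_pullback_def pb_ob_def by (auto simp: hom_def)

lemma pb_ex1:
  assumes "has_pullback f g" "u \<in> hom C S (src C f)" "v \<in> hom C S (src C g)" "f \<cdot> u = g \<cdot> v"
  shows "\<exists>!w. w \<in> hom C S (pb_ob f g) \<and> pb1 f g \<cdot> w = u \<and> pb2 f g \<cdot> w = v"
  using pb_props[OF assms(1)] assms(2-) unfolding is_pullback_def pb_ob_def by blast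

lemma pb_pair_props:
  assumes "has_pullback f g" "u \<in> hom C S (src C f)" "v \<in> hom C S (src C g)" "f \<cdot> u = g \<cdot> v"
  shows "pb_pair f g u v \<in> hom C S (pb_ob f g)"
    "pb1 f g \<cdot> pb_pair f g u v = u" "pb2 f g \<cdot> pb_pair f g u v = v"
  using theI'[OF pb_ex1[OF assms]] homD[OF assms(2)] unfolding pb_pair_def by auto

lemma pb_pair_eqI:
  assumes "has_pullback f g" "w \<in> hom C S (pb_ob f g)" "pb1 f g \<cdot> w = u" "pb2 f g \<cdot> w = v"
  shows "w = pb_pair f g u v"
proof -
  note h = pb_homs[OF assms(1)]
  have u: "u \<in> hom C S (src C f)" using cmp_hom[OF assms(2) h(4)] assms(3) by simp
  have v: "v \<in> hom C S (src C g)" using cmp_hom[OF assms(2) h(5)] assms(4) by simp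
  have e: "f \<cdot> u = g \<cdot> v"
    using cmp_assoc[OF assms(2) h(4) h(1)] cmp_assoc[OF assms(2) h(5) h(2)] h(6) assms(3,4) by simp
  show ?thesis using pb_ex1[OF assms(1) u v e] pb_pair_props[OF assms(1) u v e] assms(2-4) by blast
qed

lemma pb_pair_cmp:
  assumes "has_pullback f g" "u \<in> hom C S (src C f)" "v \<in> hom C S (src C g)" "f \<cdot> u = g \<cdot> v"
    and t: "t \<in> hom C R S"
  shows "pb_pair f g u v \<cdot> t = pb_pair f g (u \<cdot> t) (v \<cdot> t)"
proof -
  note h = pb_homs[OF assms(1)]
  note p = pb_pair_props[OF assms(1-4)]
  show ?thesis
    by (rule pb_pair_eqI[OF assms(1) cmp_hom[OF t p(1)]])
      (simp_all add: cmp_assoc[OF t p(1) h(4), symmetric] cmp_assoc[OF t p(1) h(5), symmetric] p)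
qed

lemma has_pullback_rgraph:
  assumes "has_split_epi_pullbacks" "is_rgraph G"
  shows "has_pullback (gd G) (gc G)"
proof -
  have "gd G \<in> Ar C" "gc G \<in> Ar C" "src C (gd G) = C1 G" "src C (gc G) = C1 G"
    "tgt C (gd G) = C0 G" "tgt C (gc G) = C0 G" "ge G \<in> hom C (C0 G) (C1 G)"
    "gd G \<cdot> ge G = \<one> (C0 G)" "gc G \<cdot> ge G = \<one> (C0 G)"
    using assms(2) by (auto simp: is_rgraph_def hom_def)
  then show ?thesis using assms(1) unfolding has_split_epi_pullbacks_def split_epi_def by metis
qed

lemma structure_cat_category:
  assumes P: "\<And>G. P G \<Longrightarrow> is_rgraph G"
    and Q: "\<And>f. Q f \<Longrightarrow> is_rg_mor f \<and> P (gsrc f) \<and> P (gtgt f)"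
    and QI: "\<And>G. P G \<Longrightarrow> Q (GMor G G (\<one> (C1 G)) (\<one> (C0 G)))"
    and QC: "\<And>f g. Q f \<Longrightarrow> Q g \<Longrightarrow> gtgt f = gsrc g \<Longrightarrow>
       Q (GMor (gsrc f) (gtgt g) (mor1 g \<cdot> mor1 f) (mor0 g \<cdot> mor0 f))"
  shows "category (structure_cat P Q)"
proof
  fix f X Y assume "f \<in> hom (structure_cat P Q) X Y"
  then have q: "Q f" "gsrc f = X" "gtgt f = Y" by (auto simp: hom_def structure_cat_def)
  then have h: "mor1 f \<in> hom C (C1 X) (C1 Y)" "mor0 f \<in> hom C (C0 X) (C0 Y)"
    using Q[of f] by (auto simp: is_rg_mor_def)
  show "cmp (structure_cat P Q) f (ident (structure_cat P Q) X) = f"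
   and "cmp (structure_cat P Q) (ident (structure_cat P Q) Y) f = f"
    using q h by (cases f; simp add: structure_cat_def cmp_ident ident_cmp)+
next
  fix f g h W X Y Z
  assume "f \<in> hom (structure_cat P Q) W X" "g \<in> hom (structure_cat P Q) X Y"
    "h \<in> hom (structure_cat P Q) Y Z"
  then have q: "Q f" "gsrc f = W" "gtgt f = X" "Q g" "gsrc g = X" "gtgt g = Y"
    "Q h" "gsrc h = Y" "gtgt h = Z" by (auto simp: hom_def structure_cat_def)
  then show "cmp (structure_cat P Q) (cmp (structure_cat P Q) h g) f
      = cmp (structure_cat P Q) h (cmp (structure_cat P Q) g f)"
    using Q[of f] Q[of g] Q[of h] by (auto simp: structure_cat_def is_rg_mor_def intro!: cmp_assoc)
next
  fix f g X Y Z
  assume "f \<in> hom (structure_cat P Q) X Y" "g \<in> hom (structure_cat P Q) Y Z"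
  then have "Q f" "Q g" "gtgt f = gsrc g" "gsrc f = X" "gtgt g = Z"
    by (auto simp: hom_def structure_cat_def)
  then show "cmp (structure_cat P Q) g f \<in> hom (structure_cat P Q) X Z"
    using QC[of f g] by (simp add: hom_def structure_cat_def)
qed (simp_all add: structure_cat_def hom_def Q QI)

lemma rgraph_Ob: "is_rgraph G \<Longrightarrow> C1 G \<in> Ob C \<and> C0 G \<in> Ob C"
  unfolding is_rgraph_def using hom_Ob by blast

lemma rg_mor_ident: "is_rgraph G \<Longrightarrow> is_rg_mor (GMor G G (\<one> (C1 G)) (\<one> (C0 G)))"
  using rgraph_Ob[of G] unfolding is_rg_mor_def
  by (auto simp: is_rgraph_def ident_hom cmp_ident ident_cmp)

lemma square_paste:
  assumes "f \<in> hom C X Y" "g \<in> hom C Y Z" "f' \<in> hom C X' Y'" "g' \<in> hom C Y' Z'"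
    "a \<in> hom C X X'" "b \<in> hom C Y Y'" "c \<in> hom C Z Z'" "b \<cdot> f = f' \<cdot> a" "c \<cdot> g = g' \<cdot> b"
  shows "c \<cdot> (g \<cdot> f) = (g' \<cdot> f') \<cdot> a"
  using cmp_assoc[OF assms(1,2,7)] cmp_assoc[OF assms(1,6,4)] cmp_assoc[OF assms(5,3,4)] assms(8,9)
  by simp

lemma rg_mor_cmp:
  assumes "is_rg_mor f" "is_rg_mor g" "gtgt f = gsrc g"
  shows "is_rg_mor (GMor (gsrc f) (gtgt g) (mor1 g \<cdot> mor1 f) (mor0 g \<cdot> mor0 f))"
proof -
  define G H K where GHK: "G = gsrc f" "H = gsrc g" "K = gtgt g"
  have r: "is_rgraph G" "is_rgraph H" "is_rgraph K"
    and fg: "mor1 f \<in> hom C (C1 G) (C1 H)" "mor1 g \<in> hom C (C1 H) (C1 K)"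
      "mor0 f \<in> hom C (C0 G) (C0 H)" "mor0 g \<in> hom C (C0 H) (C0 K)"
      "gd H \<cdot> mor1 f = mor0 f \<cdot> gd G" "gc H \<cdot> mor1 f = mor0 f \<cdot> gc G"
      "gd K \<cdot> mor1 g = mor0 g \<cdot> gd H" "gc K \<cdot> mor1 g = mor0 g \<cdot> gc H"
      "mor1 f \<cdot> ge G = ge H \<cdot> mor0 f" "mor1 g \<cdot> ge H = ge K \<cdot> mor0 g"
    using assms unfolding GHK is_rg_mor_def by auto
  have dc: "gd G \<in> hom C (C1 G) (C0 G)" "gc G \<in> hom C (C1 G) (C0 G)" "ge G \<in> hom C (C0 G) (C1 G)"
     "gd H \<in> hom C (C1 H) (C0 H)" "gc H \<in> hom C (C1 H) (C0 H)" "ge H \<in> hom C (C0 H) (C1 H)"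
     "gd K \<in> hom C (C1 K) (C0 K)" "gc K \<in> hom C (C1 K) (C0 K)" "ge K \<in> hom C (C0 K) (C1 K)"
    using r by (auto simp: is_rgraph_def)
  have "gd K \<cdot> (mor1 g \<cdot> mor1 f) = (mor0 g \<cdot> mor0 f) \<cdot> gd G"
    by (rule square_paste[OF fg(1,2,3,4) dc(1,4,7)]) (simp_all add: fg)
  moreover have "gc K \<cdot> (mor1 g \<cdot> mor1 f) = (mor0 g \<cdot> mor0 f) \<cdot> gc G"
    by (rule square_paste[OF fg(1,2,3,4) dc(2,5,8)]) (simp_all add: fg)
  moreover have "ge K \<cdot> (mor0 g \<cdot> mor0 f) = (mor1 g \<cdot> mor1 f) \<cdot> ge G"
    by (rule square_paste[OF fg(3,4,1,2) dc(3,6,9)]) (simp_all add: fg)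
  ultimately show ?thesis
    unfolding is_rg_mor_def gmor.sel GHK[symmetric]
    by (intro conjI r cmp_hom[OF fg(1,2)] cmp_hom[OF fg(3,4)]) (assumption | rule sym)+
qed

theorem category_RG: "category RG"
  unfolding RG_def
proof (rule structure_cat_category)
  show "is_rg_mor f \<Longrightarrow> is_rg_mor f \<and> is_rgraph (gsrc f) \<and> is_rgraph (gtgt f)"
    for f :: "(('o, 'a) rgraph, 'a) gmor" by (simp add: is_rg_mor_def)
qed (assumption | rule rg_mor_ident rg_mor_cmp)+

lemma icat_mor_ident:
  assumes "has_split_epi_pullbacks" "is_icat G"
  shows "is_icat_mor (GMor G G (\<one> (C1 G)) (\<one> (C0 G)))"
proof -
  have r: "is_rgraph G" using assms by (simp add: is_icat_def)
  note pb = has_pullback_rgraph[OF assms(1) r]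
  note h = pb_homs[OF pb]
  have s: "src C (gd G) = C1 G" "src C (gc G) = C1 G" using r by (auto simp: is_rgraph_def hom_def)
  have m: "gm G \<in> hom C (pb_ob (gd G) (gc G)) (C1 G)" using assms by (simp add: is_icat_def)
  have o: "pb_ob (gd G) (gc G) \<in> Ob C" using hom_Ob[OF m] by simp
  have "\<one> (pb_ob (gd G) (gc G)) = cpair G (pb1 (gd G) (gc G)) (pb2 (gd G) (gc G))"
    by (rule pb_pair_eqI[OF pb ident_hom[OF o]]) (use h o in \<open>auto simp: cmp_ident\<close>)
  then show ?thesis using rg_mor_ident[OF r] assms m h s unfolding is_icat_mor_def
    by (simp add: ident_cmp cmp_ident) (metis cmp_ident)
qed

lemma icat_mor_cmp:
  assumes E: "has_split_epi_pullbacks" and f: "is_icat_mor f" and g: "is_icat_mor g"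
    and e: "gtgt f = gsrc g"
  shows "is_icat_mor (GMor (gsrc f) (gtgt g) (mor1 g \<cdot> mor1 f) (mor0 g \<cdot> mor0 f))"
proof -
  define G H K where GHK: "G = gsrc f" "H = gsrc g" "K = gtgt g"
  have i: "is_icat G" "is_icat H" "is_icat K" and r: "is_rgraph G" "is_rgraph H" "is_rgraph K"
    using f g e unfolding GHK is_icat_mor_def is_icat_def by auto
  note pbG = has_pullback_rgraph[OF E r(1)] and pbH = has_pullback_rgraph[OF E r(2)]
    and pbK = has_pullback_rgraph[OF E r(3)]
  have s: "src C (gd G) = C1 G" "src C (gc G) = C1 G" "src C (gd H) = C1 H" "src C (gc H) = C1 H"
    "src C (gd K) = C1 K" "src C (gc K) = C1 K"
    using r by (auto simp: is_rgraph_def hom_def)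
  let ?P = "pb_ob (gd G) (gc G)"
  let ?p = "pb1 (gd G) (gc G)" and ?q = "pb2 (gd G) (gc G)"
  let ?p' = "pb1 (gd H) (gc H)" and ?q' = "pb2 (gd H) (gc H)"
  have p: "?p \<in> hom C ?P (C1 G)" "?q \<in> hom C ?P (C1 G)" "gd G \<cdot> ?p = gc G \<cdot> ?q"
    using pb_homs[OF pbG] s by auto
  have p': "?p' \<in> hom C (pb_ob (gd H) (gc H)) (C1 H)" "?q' \<in> hom C (pb_ob (gd H) (gc H)) (C1 H)"
     "gd H \<cdot> ?p' = gc H \<cdot> ?q'"
    using pb_homs[OF pbH] s by auto
  have fg: "mor1 f \<in> hom C (C1 G) (C1 H)" "mor1 g \<in> hom C (C1 H) (C1 K)"
    "mor0 f \<in> hom C (C0 G) (C0 H)" "mor0 g \<in> hom C (C0 H) (C0 K)"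
    "gd H \<cdot> mor1 f = mor0 f \<cdot> gd G" "gc H \<cdot> mor1 f = mor0 f \<cdot> gc G"
    "gd K \<cdot> mor1 g = mor0 g \<cdot> gd H" "gc K \<cdot> mor1 g = mor0 g \<cdot> gc H"
    using f g e unfolding GHK is_icat_mor_def is_rg_mor_def by auto
  have dc: "gd G \<in> hom C (C1 G) (C0 G)" "gc G \<in> hom C (C1 G) (C0 G)"
     "gd H \<in> hom C (C1 H) (C0 H)" "gc H \<in> hom C (C1 H) (C0 H)"
     "gd K \<in> hom C (C1 K) (C0 K)" "gc K \<in> hom C (C1 K) (C0 K)"
    using r by (auto simp: is_rgraph_def)
  have gm: "gm G \<in> hom C ?P (C1 G)" "gm H \<in> hom C (pb_ob (gd H) (gc H)) (C1 H)"
     "gm K \<in> hom C (pb_ob (gd K) (gc K)) (C1 K)" using i by (auto simp: is_icat_def)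
  have mf: "mor1 f \<cdot> gm G = gm H \<cdot> cpair H (mor1 f \<cdot> ?p) (mor1 f \<cdot> ?q)"
    and mg: "mor1 g \<cdot> gm H = gm K \<cdot> cpair K (mor1 g \<cdot> ?p') (mor1 g \<cdot> ?q')"
    using f g e unfolding GHK is_icat_mor_def by auto
  have c1: "gd H \<cdot> mor1 f \<cdot> ?p = gc H \<cdot> mor1 f \<cdot> ?q"
    using cmp_assoc[OF p(1) fg(1) dc(3)] cmp_assoc[OF p(2) fg(1) dc(4)] fg(5,6) p(3)
      cmp_assoc[OF p(1) dc(1) fg(3)] cmp_assoc[OF p(2) dc(2) fg(3)] by simp
  have c2: "gd K \<cdot> mor1 g \<cdot> ?p' = gc K \<cdot> mor1 g \<cdot> ?q'"
    using cmp_assoc[OF p'(1) fg(2) dc(5)] cmp_assoc[OF p'(2) fg(2) dc(6)] fg(7,8) p'(3)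
      cmp_assoc[OF p'(1) dc(3) fg(4)] cmp_assoc[OF p'(2) dc(4) fg(4)] by simp
  let ?w = "cpair H (mor1 f \<cdot> ?p) (mor1 f \<cdot> ?q)"
  have a: "mor1 f \<cdot> ?p \<in> hom C ?P (src C (gd H))" "mor1 f \<cdot> ?q \<in> hom C ?P (src C (gc H))"
    using p fg s by (auto intro: cmp_hom)
  have b: "mor1 g \<cdot> ?p' \<in> hom C (pb_ob (gd H) (gc H)) (src C (gd K))"
    "mor1 g \<cdot> ?q' \<in> hom C (pb_ob (gd H) (gc H)) (src C (gc K))"
    using p' fg s by (auto intro: cmp_hom)
  note w = pb_pair_props[OF pbH a c1]
  note v = pb_pair_props[OF pbK b c2]
  have "(mor1 g \<cdot> mor1 f) \<cdot> gm G = mor1 g \<cdot> (gm H \<cdot> ?w)"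
    using cmp_assoc[OF gm(1) fg(1) fg(2)] mf by simp
  also have "\<dots> = (gm K \<cdot> cpair K (mor1 g \<cdot> ?p') (mor1 g \<cdot> ?q')) \<cdot> ?w"
    using cmp_assoc[OF w(1) gm(2) fg(2)] mg by simp
  also have "\<dots> = gm K \<cdot> (cpair K (mor1 g \<cdot> ?p') (mor1 g \<cdot> ?q') \<cdot> ?w)"
    by (rule cmp_assoc[OF w(1) v(1) gm(3)])
  also have "\<dots> = gm K \<cdot> cpair K ((mor1 g \<cdot> ?p') \<cdot> ?w) ((mor1 g \<cdot> ?q') \<cdot> ?w)"
    by (simp add: pb_pair_cmp[OF pbK b c2 w(1)])
  also have "\<dots> = gm K \<cdot> cpair K ((mor1 g \<cdot> mor1 f) \<cdot> ?p) ((mor1 g \<cdot> mor1 f) \<cdot> ?q)"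
    using cmp_assoc[OF w(1) p'(1) fg(2)] cmp_assoc[OF w(1) p'(2) fg(2)] w(2,3)
      cmp_assoc[OF p(1) fg(1,2)] cmp_assoc[OF p(2) fg(1,2)] by simp
  finally have "(mor1 g \<cdot> mor1 f) \<cdot> gm G =
    gm K \<cdot> cpair K ((mor1 g \<cdot> mor1 f) \<cdot> ?p) ((mor1 g \<cdot> mor1 f) \<cdot> ?q)" .
  then show ?thesis
    using rg_mor_cmp[of f g] f g e i unfolding GHK is_icat_mor_def by simp
qed

theorem category_Cat:
  assumes "has_split_epi_pullbacks"
  shows "category Cat"
  unfolding Cat_def
proof (rule structure_cat_category)
  show "is_icat_mor f \<Longrightarrow> is_rg_mor f \<and> is_icat (gsrc f) \<and> is_icat (gtgt f)"
    for f :: "(('o, 'a) icat, 'a) gmor" by (simp add: is_icat_mor_def)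
  show "is_icat G \<Longrightarrow> is_rgraph G" for G :: "('o, 'a) icat" by (simp add: is_icat_def)
qed (assumption | rule icat_mor_ident[OF assms] icat_mor_cmp[OF assms])+

theorem category_Grpd:
  assumes "has_split_epi_pullbacks"
  shows "category Grpd"
  unfolding Grpd_def
proof (rule structure_cat_category)
  fix G :: "('o, 'a) igrpd" assume G: "is_igrpd G"
  then have "is_icat G" by (simp add: is_igrpd_def)
  then show "is_igrpd_mor (GMor G G (\<one> (C1 G)) (\<one> (C0 G)))"
    using G icat_mor_ident[OF assms, of G] unfolding is_igrpd_mor_def
    by (auto simp: is_igrpd_def cmp_ident ident_cmp)
next
  fix f g :: "(('o, 'a) igrpd, 'a) gmor"
  assume fg: "is_igrpd_mor f" "is_igrpd_mor g" "gtgt f = gsrc g"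
  then have "is_icat_mor (GMor (gsrc f) (gtgt g) (mor1 g \<cdot> mor1 f) (mor0 g \<cdot> mor0 f))"
    by (intro icat_mor_cmp[OF assms]) (simp_all add: is_igrpd_mor_def)
  moreover have "(mor1 g \<cdot> mor1 f) \<cdot> gi (gsrc f) = gi (gtgt g) \<cdot> (mor1 g \<cdot> mor1 f)"
  proof (rule square_paste[symmetric])
    show "mor1 f \<in> hom C (C1 (gsrc f)) (C1 (gsrc g))" "mor1 g \<in> hom C (C1 (gsrc g)) (C1 (gtgt g))"
      "mor1 f \<in> hom C (C1 (gsrc f)) (C1 (gsrc g))" "mor1 g \<in> hom C (C1 (gsrc g)) (C1 (gtgt g))"
      "gi (gsrc f) \<in> hom C (C1 (gsrc f)) (C1 (gsrc f))"
      "gi (gsrc g) \<in> hom C (C1 (gsrc g)) (C1 (gsrc g))"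
      "gi (gtgt g) \<in> hom C (C1 (gtgt g)) (C1 (gtgt g))"
      "gi (gsrc g) \<cdot> mor1 f = mor1 f \<cdot> gi (gsrc f)"
      "gi (gtgt g) \<cdot> mor1 g = mor1 g \<cdot> gi (gsrc g)"
      using fg unfolding is_igrpd_mor_def is_igrpd_def is_icat_mor_def is_rg_mor_def by simp_all
  qed
  ultimately show "is_igrpd_mor (GMor (gsrc f) (gtgt g) (mor1 g \<cdot> mor1 f) (mor0 g \<cdot> mor0 f))"
    using fg unfolding is_igrpd_mor_def by simp
next
  show "is_igrpd_mor f \<Longrightarrow> is_rg_mor f \<and> is_igrpd (gsrc f) \<and> is_igrpd (gtgt f)"
    for f :: "(('o, 'a) igrpd, 'a) gmor" by (simp add: is_igrpd_mor_def is_icat_mor_def)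
  show "is_igrpd G \<Longrightarrow> is_rgraph G" for G :: "('o, 'a) igrpd"
    by (simp add: is_igrpd_def is_icat_def)
qed

lemma truncate_simps:
  "C1 (rgraph.truncate G) = C1 G" "C0 (rgraph.truncate G) = C0 G" "gd (rgraph.truncate G) = gd G"
  "ge (rgraph.truncate G) = ge G" "gc (rgraph.truncate G) = gc G"
  by (auto simp: rgraph.truncate_def)

lemma truncate_rgraph: "is_rgraph (rgraph.truncate G) = is_rgraph G"
  by (simp add: is_rgraph_def truncate_simps)

lemma truncate_rg_mor: "is_rg_mor f \<Longrightarrow> is_rg_mor (forget_ar rgraph.truncate f)"
  by (simp add: is_rg_mor_def forget_ar_def truncate_simps truncate_rgraph)

lemma forgetful_functor_structure_cat:
  assumes "category (structure_cat P Q)"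
    and P: "\<And>G. P G \<Longrightarrow> is_rgraph G" and Q: "\<And>f. Q f \<Longrightarrow> is_rg_mor f"
  shows "cat_functor (structure_cat P Q) RG rgraph.truncate (forget_ar rgraph.truncate)"
proof (intro cat_functor.intro cat_functor_axioms.intro assms(1) category_RG)
  show "G \<in> Ob (structure_cat P Q) \<Longrightarrow> rgraph.truncate G \<in> Ob RG" for G
    using P[of G] by (simp add: structure_cat_def RG_def truncate_rgraph)
  show "f \<in> hom (structure_cat P Q) G H \<Longrightarrow>
      forget_ar rgraph.truncate f \<in> hom RG (rgraph.truncate G) (rgraph.truncate H)" for f G H
    using truncate_rg_mor[OF Q[of f]]
    by (auto simp: structure_cat_def RG_def hom_def forget_ar_def)
qed (simp_all add: structure_cat_def RG_def forget_ar_def truncate_simps)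

theorem forgetful_functor_Cat:
  assumes "has_split_epi_pullbacks"
  shows "cat_functor Cat RG rgraph.truncate (forget_ar rgraph.truncate)"
  unfolding Cat_def
  by (rule forgetful_functor_structure_cat[OF category_Cat[OF assms, unfolded Cat_def]])
    (simp_all add: is_icat_def is_icat_mor_def)

theorem forgetful_functor_Grpd:
  assumes "has_split_epi_pullbacks"
  shows "cat_functor Grpd RG rgraph.truncate (forget_ar rgraph.truncate)"
  unfolding Grpd_def
  by (rule forgetful_functor_structure_cat[OF category_Grpd[OF assms, unfolded Grpd_def]])
    (simp_all add: is_igrpd_def is_igrpd_mor_def is_icat_def is_icat_mor_def)

lemma pregroupoidD:
  assumes "is_pregroupoid d c p"
  shows "p \<in> hom C (span_ob d c) (src C d)"
    "\<lbrakk>x \<in> hom C S (src C d); y \<in> hom C S (src C d); z \<in> hom C S (src C d);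
      d \<cdot> x = d \<cdot> y; c \<cdot> y = c \<cdot> z\<rbrakk> \<Longrightarrow> d \<cdot> p \<cdot> span_triple d c x y z = d \<cdot> z"
    "\<lbrakk>x \<in> hom C S (src C d); y \<in> hom C S (src C d); z \<in> hom C S (src C d);
      d \<cdot> x = d \<cdot> y; c \<cdot> y = c \<cdot> z\<rbrakk> \<Longrightarrow> c \<cdot> p \<cdot> span_triple d c x y z = c \<cdot> x"
    "\<lbrakk>x \<in> hom C S (src C d); y \<in> hom C S (src C d); d \<cdot> x = d \<cdot> y\<rbrakk>
      \<Longrightarrow> p \<cdot> span_triple d c x y y = x"
    "\<lbrakk>y \<in> hom C S (src C d); z \<in> hom C S (src C d); c \<cdot> y = c \<cdot> z\<rbrakk>
      \<Longrightarrow> p \<cdot> span_triple d c y y z = z"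
  using assms unfolding is_pregroupoid_def by metis+

lemma span_props:
  assumes "has_split_epi_pullbacks" "is_span d c"
  shows "has_pullback d d" "has_pullback c c" "has_pullback (pb2 d d) (pb1 c c)"
    "d \<in> hom C (src C d) (tgt C d)" "c \<in> hom C (src C d) (tgt C c)" "src C c = src C d"
    "src C (pb2 d d) = pb_ob d d" "src C (pb1 c c) = pb_ob c c"
proof -
  show sp: "has_pullback d d" "has_pullback c c" "d \<in> hom C (src C d) (tgt C d)"
    "c \<in> hom C (src C d) (tgt C c)" "src C c = src C d"
    using assms(2) by (auto simp: is_span_def hom_def)
  note hd = pb_homs[OF sp(1)] and hc = pb_homs[OF sp(2), unfolded sp(5)]
  have i: "\<one> (src C d) \<in> hom C (src C d) (src C d)" using hom_Ob[OF sp(3)] ident_hom by simp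
  note pd = pb_pair_props[OF sp(1) i i refl]
    and pc = pb_pair_props[OF sp(2), unfolded sp(5), OF i i refl]
  show s: "src C (pb2 d d) = pb_ob d d" "src C (pb1 c c) = pb_ob c c"
    using hd(5) hc(4) by (auto simp: hom_def)
  have t: "tgt C (pb2 d d) = src C d" "tgt C (pb1 c c) = src C d"
    "pb2 d d \<in> Ar C" "pb1 c c \<in> Ar C"
    using hd(5) hc(4) by (auto simp: hom_def)
  have "split_epi (pb2 d d)" "split_epi (pb1 c c)"
    unfolding split_epi_def s t(1,2) using t(3,4) pd pc by blast+
  then show "has_pullback (pb2 d d) (pb1 c c)"
    using assms(1) t unfolding has_split_epi_pullbacks_def by metis
qed

lemma span_triple_props:
  assumes "has_split_epi_pullbacks" "is_span d c"
    and x: "x \<in> hom C S (src C d)" and y: "y \<in> hom C S (src C d)" and z: "z \<in> hom C S (src C d)"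
    and xy: "d \<cdot> x = d \<cdot> y" and yz: "c \<cdot> y = c \<cdot> z"
  shows "span_triple d c x y z \<in> hom C S (span_ob d c)"
    and "t \<in> hom C R S \<Longrightarrow>
      span_triple d c x y z \<cdot> t = span_triple d c (x \<cdot> t) (y \<cdot> t) (z \<cdot> t)"
    and "\<lbrakk>w \<in> hom C S (span_ob d c);
       pb1 d d \<cdot> pb1 (pb2 d d) (pb1 c c) \<cdot> w = x; pb2 d d \<cdot> pb1 (pb2 d d) (pb1 c c) \<cdot> w = y;
       pb2 c c \<cdot> pb2 (pb2 d d) (pb1 c c) \<cdot> w = z\<rbrakk> \<Longrightarrow> w = span_triple d c x y z"
    and "pb1 d d \<cdot> pb1 (pb2 d d) (pb1 c c) \<cdot> span_triple d c x y z = x"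
    and "pb2 d d \<cdot> pb1 (pb2 d d) (pb1 c c) \<cdot> span_triple d c x y z = y"
    and "pb2 c c \<cdot> pb2 (pb2 d d) (pb1 c c) \<cdot> span_triple d c x y z = z"
proof -
  note sp = span_props[OF assms(1,2)]
  note hd = pb_homs[OF sp(1)] and hc = pb_homs[OF sp(2), unfolded sp(6)]
    and h = pb_homs[OF sp(3), unfolded sp(7,8)]
  note pd = pb_pair_props[OF sp(1) x y xy]
    and pc = pb_pair_props[OF sp(2), unfolded sp(6), OF y z yz]
  have e: "pb2 d d \<cdot> pb_pair d d x y = pb1 c c \<cdot> pb_pair c c y z" using pd pc by simp
  note p = pb_pair_props[OF sp(3), unfolded sp(7,8), OF pd(1) pc(1) e]
  show "span_triple d c x y z \<in> hom C S (span_ob d c)"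
    using p by (simp add: span_triple_def span_ob_def)
  show "span_triple d c x y z \<cdot> t = span_triple d c (x \<cdot> t) (y \<cdot> t) (z \<cdot> t)" if "t \<in> hom C R S"
    unfolding span_triple_def
    by (simp add: pb_pair_cmp[OF sp(3), unfolded sp(7,8), OF pd(1) pc(1) e that]
      pb_pair_cmp[OF sp(1) x y xy that] pb_pair_cmp[OF sp(2), unfolded sp(6), OF y z yz that])
  show "pb1 d d \<cdot> pb1 (pb2 d d) (pb1 c c) \<cdot> span_triple d c x y z = x"
   "pb2 d d \<cdot> pb1 (pb2 d d) (pb1 c c) \<cdot> span_triple d c x y z = y"
   "pb2 c c \<cdot> pb2 (pb2 d d) (pb1 c c) \<cdot> span_triple d c x y z = z"
    unfolding span_triple_def by (simp_all add: p pd pc)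
  assume w: "w \<in> hom C S (span_ob d c)" "pb1 d d \<cdot> pb1 (pb2 d d) (pb1 c c) \<cdot> w = x"
    "pb2 d d \<cdot> pb1 (pb2 d d) (pb1 c c) \<cdot> w = y" "pb2 c c \<cdot> pb2 (pb2 d d) (pb1 c c) \<cdot> w = z"
  note w1 = w(1)[unfolded span_ob_def]
  have 1: "pb1 (pb2 d d) (pb1 c c) \<cdot> w = pb_pair d d x y"
    by (rule pb_pair_eqI[OF sp(1) cmp_hom[OF w1 h(4)] w(2,3)])
  have "pb1 c c \<cdot> pb2 (pb2 d d) (pb1 c c) \<cdot> w = pb2 d d \<cdot> pb1 (pb2 d d) (pb1 c c) \<cdot> w"
    using cmp_assoc[OF w1 h(4) hd(5)] cmp_assoc[OF w1 h(5) hc(4)] h(6) by simp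
  then have "pb1 c c \<cdot> pb2 (pb2 d d) (pb1 c c) \<cdot> w = y" using w(3) by simp
  then have 2: "pb2 (pb2 d d) (pb1 c c) \<cdot> w = pb_pair c c y z"
    by (rule pb_pair_eqI[OF sp(2) cmp_hom[OF w1 h(5)] _ w(4)])
  show "w = span_triple d c x y z"
    unfolding span_triple_def by (rule pb_pair_eqI[OF sp(3) w1 1 2])
qed

lemma terminal_span:
  assumes T: "is_terminal T" and "has_binary_products" and b: "b \<in> hom C X T"
  shows "is_span b b"
proof -
  have X: "X \<in> Ob C" using hom_Ob[OF b] by simp
  then obtain p q where pq: "is_product X X p q"
    using assms(2) unfolding has_binary_products_def by blast
  have s: "b \<in> Ar C" "src C b = X" using b by (auto simp: hom_def)
  have p: "p \<in> hom C (src C p) X" "q \<in> hom C (src C p) X" using pq by (auto simp: is_product_def)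
  have "b \<cdot> p = b \<cdot> q"
    using T hom_Ob[OF p(1)] cmp_hom[OF p(1) b] cmp_hom[OF p(2) b] unfolding is_terminal_def by blast
  then have "is_pullback b b p q"
    using pq s unfolding is_pullback_def is_product_def by simp
  then show ?thesis using s unfolding is_span_def has_pullback_def by blast
qed

text \<open>Associativity is not part of the definition of canonical pregroupoid structures,
  since it is a consequence of naturality.\<close>

theorem canonical_pregroupoids_assoc:
  assumes E: "has_split_epi_pullbacks" and fp: "has_finite_products"
    and can: "canonical_pregroupoids p" and dc: "is_span d c"
    and hs: "u \<in> hom C S (src C d)" "v \<in> hom C S (src C d)" "x \<in> hom C S (src C d)"
      "y \<in> hom C S (src C d)" "z \<in> hom C S (src C d)"
    and eqs: "d \<cdot> u = d \<cdot> v" "c \<cdot> v = c \<cdot> x" "d \<cdot> x = d \<cdot> y" "c \<cdot> y = c \<cdot> z"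
  shows "p d c \<cdot> span_triple d c u v (p d c \<cdot> span_triple d c x y z)
       = p d c \<cdot> span_triple d c (p d c \<cdot> span_triple d c u v x) y z"
proof -
  obtain T where T: "is_terminal T" and bp: "has_binary_products"
    using fp by (auto simp: has_finite_products_def)
  define b where "b X = (THE t. t \<in> hom C X T)" for X
  have b: "b X \<in> hom C X T" if "X \<in> Ob C" for X
    unfolding b_def using theI'[of "\<lambda>t. t \<in> hom C X T"] T that by (auto simp: is_terminal_def)
  have Tu: "f = g" if "f \<in> hom C X T" "g \<in> hom C X T" for f g X
    using T hom_Ob[OF that(1)] that unfolding is_terminal_def by blast
  have bs: "is_span (b X) (b X)" "src C (b X) = X" "tgt C (b X) = T" if "X \<in> Ob C" for X
    using terminal_span[OF T bp b[OF that]] b[OF that] by (auto simp: hom_def)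
  have pg: "is_pregroupoid d' c' (p d' c')" if "is_span d' c'" for d' c'
    using can that by (simp add: canonical_pregroupoids_def)
  have nat: "f \<cdot> p d1 c1 \<cdot> span_triple d1 c1 x y z
               = p d2 c2 \<cdot> span_triple d2 c2 (f \<cdot> x) (f \<cdot> y) (f \<cdot> z)"
    if "is_span d1 c1" "is_span d2 c2" "f \<in> hom C (src C d1) (src C d2)"
      "f0 \<in> hom C (tgt C d1) (tgt C d2)" "f1 \<in> hom C (tgt C c1) (tgt C c2)"
      "d2 \<cdot> f = f0 \<cdot> d1" "c2 \<cdot> f = f1 \<cdot> c1"
      "x \<in> hom C S (src C d1)" "y \<in> hom C S (src C d1)" "z \<in> hom C S (src C d1)"
      "d1 \<cdot> x = d1 \<cdot> y" "c1 \<cdot> y = c1 \<cdot> z" for d1 c1 d2 c2 f f0 f1 S x y z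
    using can that unfolding canonical_pregroupoids_def natural_pregroupoids_def by blast
  define P where "P X = p (b X) (b X)" for X
  define Q where "Q X = span_ob (b X) (b X)" for X
  define M where "M X x y z = P X \<cdot> span_triple (b X) (b X) x y z" for X x y z
  have bx: "b X \<cdot> x = b X \<cdot> y" if "x \<in> hom C S X" "y \<in> hom C S X" for S X x y
  proof -
    have X: "X \<in> Ob C" using hom_Ob[OF that(1)] by simp
    show ?thesis by (rule Tu[OF cmp_hom[OF that(1) b[OF X]] cmp_hom[OF that(2) b[OF X]]])
  qed
  have st: "span_triple (b X) (b X) x y z \<in> hom C S (Q X)"
    if "x \<in> hom C S X" "y \<in> hom C S X" "z \<in> hom C S X" for S X x y z
  proof -
    have X: "X \<in> Ob C" using hom_Ob[OF that(1)] by simp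
    show ?thesis unfolding Q_def
      by (rule span_triple_props(1)[OF E bs(1)[OF X], unfolded bs(2)[OF X],
            OF that bx[OF that(1,2)] bx[OF that(2,3)]])
  qed
  have P: "P X \<in> hom C (Q X) X" if "X \<in> Ob C" for X
    using pg[OF bs(1)[OF that]] bs(2)[OF that] pregroupoidD(1)[of "b X" "b X"] by (simp add: P_def Q_def)
  have M: "M X x y z \<in> hom C S X"
    if "x \<in> hom C S X" "y \<in> hom C S X" "z \<in> hom C S X" for S X x y z
    unfolding M_def using cmp_hom[OF st[OF that] P] hom_Ob[OF that(1)] by simp
  have M1: "M X x y y = x" if "x \<in> hom C S X" "y \<in> hom C S X" for S X x y
  proof -
    have X: "X \<in> Ob C" using hom_Ob[OF that(1)] by simp
    show ?thesis unfolding M_def P_def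
      by (rule pregroupoidD(4)[OF pg[OF bs(1)[OF X]], unfolded bs(2)[OF X], OF that bx[OF that]])
  qed
  have M2: "M X y y z = z" if "y \<in> hom C S X" "z \<in> hom C S X" for S X y z
  proof -
    have X: "X \<in> Ob C" using hom_Ob[OF that(1)] by simp
    show ?thesis unfolding M_def P_def
      by (rule pregroupoidD(5)[OF pg[OF bs(1)[OF X]], unfolded bs(2)[OF X], OF that bx[OF that]])
  qed
  have Mnat: "f \<cdot> M X x y z = M Y (f \<cdot> x) (f \<cdot> y) (f \<cdot> z)"
    if f: "f \<in> hom C X Y" and "x \<in> hom C S X" "y \<in> hom C S X" "z \<in> hom C S X" for f X Y S x y z
  proof -
    have XY: "X \<in> Ob C" "Y \<in> Ob C" "T \<in> Ob C" using hom_Ob[OF f] T by (auto simp: is_terminal_def)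
    have e: "b Y \<cdot> f = \<one> T \<cdot> b X"
      using Tu cmp_hom[OF f b[OF XY(2)]] cmp_hom[OF b[OF XY(1)] ident_hom[OF XY(3)]] by blast
    show ?thesis unfolding M_def P_def
      by (rule nat[OF bs(1)[OF XY(1)] bs(1)[OF XY(2)],
            unfolded bs(2)[OF XY(1)] bs(2)[OF XY(2)] bs(3)[OF XY(1)] bs(3)[OF XY(2)],
            OF f ident_hom[OF XY(3)] ident_hom[OF XY(3)] e e that(2-4)
              bx[OF that(2,3)] bx[OF that(3,4)]])
  qed
  have Mp: "p d c \<cdot> span_triple d c x y z = M (src C d) x y z"
    if xyz: "x \<in> hom C S (src C d)" "y \<in> hom C S (src C d)" "z \<in> hom C S (src C d)"
      and e: "d \<cdot> x = d \<cdot> y" "c \<cdot> y = c \<cdot> z" for x y z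
  proof -
    let ?D = "src C d"
    note sp = span_props[OF E dc]
    have D: "?D \<in> Ob C" "tgt C d \<in> Ob C" "tgt C c \<in> Ob C" using hom_Ob[OF sp(4)] hom_Ob[OF sp(5)] by auto
    have i: "\<one> ?D \<in> hom C ?D ?D" using ident_hom D by simp
    have f: "b ?D \<cdot> \<one> ?D = b (tgt C d) \<cdot> d" "b ?D \<cdot> \<one> ?D = b (tgt C c) \<cdot> c"
      using Tu cmp_hom[OF i b[OF D(1)]] cmp_hom[OF sp(4) b[OF D(2)]] cmp_hom[OF sp(5) b[OF D(3)]]
      by blast+
    have pdc: "p d c \<in> hom C (span_ob d c) ?D" by (rule pregroupoidD(1)[OF pg[OF dc]])
    have "\<one> ?D \<cdot> p d c \<cdot> span_triple d c x y z = M ?D (\<one> ?D \<cdot> x) (\<one> ?D \<cdot> y) (\<one> ?D \<cdot> z)"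
      unfolding M_def P_def
      by (rule nat[OF dc bs(1)[OF D(1)], unfolded bs(2)[OF D(1)] bs(3)[OF D(1)],
            OF i b[OF D(2)] b[OF D(3)] f xyz e])
    then show ?thesis
      using ident_cmp[OF cmp_hom[OF span_triple_props(1)[OF E dc xyz e] pdc]] xyz
      by (simp add: ident_cmp)
  qed
  have exch: "M X (M X a1 a2 a3) (M X b1 b2 b3) (M X c1 c2 c3)
            = M X (M X a1 b1 c1) (M X a2 b2 c2) (M X a3 b3 c3)"
    if a: "a1 \<in> hom C S X" "a2 \<in> hom C S X" "a3 \<in> hom C S X"
      and b': "b1 \<in> hom C S X" "b2 \<in> hom C S X" "b3 \<in> hom C S X"
      and c': "c1 \<in> hom C S X" "c2 \<in> hom C S X" "c3 \<in> hom C S X"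
    for S X a1 a2 a3 b1 b2 b3 c1 c2 c3
  proof -
    have X: "X \<in> Ob C" using hom_Ob[OF a(1)] by simp
    let ?b = "b X" and ?st = "span_triple (b X) (b X)"
    note sp = span_props[OF E bs(1)[OF X], unfolded bs(2)[OF X]]
    note h = pb_homs[OF sp(3), unfolded sp(7,8), folded span_ob_def, folded Q_def]
    note hb = pb_homs[OF sp(1), unfolded bs(2)[OF X]]
    note pp = span_triple_props(4,5,6)[OF E bs(1)[OF X], unfolded bs(2)[OF X]]
    let ?q1 = "pb1 ?b ?b \<cdot> pb1 (pb2 ?b ?b) (pb1 ?b ?b)"
      and ?q2 = "pb2 ?b ?b \<cdot> pb1 (pb2 ?b ?b) (pb1 ?b ?b)"
      and ?q3 = "pb2 ?b ?b \<cdot> pb2 (pb2 ?b ?b) (pb1 ?b ?b)"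
    have q: "?q1 \<in> hom C (Q X) X" "?q2 \<in> hom C (Q X) X" "?q3 \<in> hom C (Q X) X"
      using cmp_hom[OF h(4) hb(4)] cmp_hom[OF h(4) hb(5)] cmp_hom[OF h(5) hb(5)] by auto
    have qa: "?q1 \<cdot> w = pb1 ?b ?b \<cdot> pb1 (pb2 ?b ?b) (pb1 ?b ?b) \<cdot> w"
      "?q2 \<cdot> w = pb2 ?b ?b \<cdot> pb1 (pb2 ?b ?b) (pb1 ?b ?b) \<cdot> w"
      "?q3 \<cdot> w = pb2 ?b ?b \<cdot> pb2 (pb2 ?b ?b) (pb1 ?b ?b) \<cdot> w"
      if "w \<in> hom C S (Q X)" for w
      using cmp_assoc[OF that h(4) hb(4)] cmp_assoc[OF that h(4) hb(5)] cmp_assoc[OF that h(5) hb(5)]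
      by auto
    have qst: "?q1 \<cdot> ?st a1 a2 a3 = a1" "?q2 \<cdot> ?st a1 a2 a3 = a2" "?q3 \<cdot> ?st a1 a2 a3 = a3"
      if "a1 \<in> hom C S X" "a2 \<in> hom C S X" "a3 \<in> hom C S X" for a1 a2 a3
      using qa[OF st[OF that]] pp[OF that bx[OF that(1,2)] bx[OF that(2,3)]] by auto
    note sa = st[OF a] and sb = st[OF b'] and sc = st[OF c']
    note Ms = M[OF a(1) b'(1) c'(1)] M[OF a(2) b'(2) c'(2)] M[OF a(3) b'(3) c'(3)]
    let ?w = "M (Q X) (?st a1 a2 a3) (?st b1 b2 b3) (?st c1 c2 c3)"
    have w: "?w \<in> hom C S (Q X)" by (rule M[OF sa sb sc])
    have "?w = ?st (M X a1 b1 c1) (M X a2 b2 c2) (M X a3 b3 c3)"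
    proof (rule span_triple_props(3)[OF E bs(1)[OF X], unfolded bs(2)[OF X]])
      show "pb1 ?b ?b \<cdot> pb1 (pb2 ?b ?b) (pb1 ?b ?b) \<cdot> ?w = M X a1 b1 c1"
        using Mnat[OF q(1) sa sb sc] qa(1)[OF w] qst(1)[OF a] qst(1)[OF b'] qst(1)[OF c'] by simp
      show "pb2 ?b ?b \<cdot> pb1 (pb2 ?b ?b) (pb1 ?b ?b) \<cdot> ?w = M X a2 b2 c2"
        using Mnat[OF q(2) sa sb sc] qa(2)[OF w] qst(2)[OF a] qst(2)[OF b'] qst(2)[OF c'] by simp
      show "pb2 ?b ?b \<cdot> pb2 (pb2 ?b ?b) (pb1 ?b ?b) \<cdot> ?w = M X a3 b3 c3"
        using Mnat[OF q(3) sa sb sc] qa(3)[OF w] qst(3)[OF a] qst(3)[OF b'] qst(3)[OF c'] by simp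
      show "?w \<in> hom C S (span_ob ?b ?b)" using w by (simp add: Q_def)
    qed (rule Ms bx[OF Ms(1) Ms(2)] bx[OF Ms(2) Ms(3)])+
    then have "P X \<cdot> ?w = M X (M X a1 b1 c1) (M X a2 b2 c2) (M X a3 b3 c3)"
      by (simp add: M_def)
    then show ?thesis using Mnat[OF P[OF X] sa sb sc] by (simp add: M_def)
  qed
  let ?D = "src C d"
  have pd: "d \<cdot> p d c \<cdot> span_triple d c x y z = d \<cdot> z" "c \<cdot> p d c \<cdot> span_triple d c x y z = c \<cdot> x"
    if "x \<in> hom C S ?D" "y \<in> hom C S ?D" "z \<in> hom C S ?D" "d \<cdot> x = d \<cdot> y" "c \<cdot> y = c \<cdot> z" for x y z
    by (rule pregroupoidD(2,3)[OF pg[OF dc] that])+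
  have 1: "p d c \<cdot> span_triple d c x y z = M ?D x y z" "p d c \<cdot> span_triple d c u v x = M ?D u v x"
    using Mp hs eqs by auto
  have 2: "c \<cdot> v = c \<cdot> M ?D x y z" "d \<cdot> M ?D u v x = d \<cdot> y"
    using pd(2)[OF hs(3,4,5) eqs(3,4)] pd(1)[OF hs(1,2,3) eqs(1,2)] 1 eqs by auto
  have "M ?D (M ?D u v x) (M ?D y y y) (M ?D y y z) = M ?D (M ?D u y y) (M ?D v y y) (M ?D x y z)"
    by (rule exch[OF hs(1,2,3,4,4,4,4,4,5)])
  then have "M ?D (M ?D u v x) y z = M ?D u v (M ?D x y z)"
    using M1[OF hs(4,4)] M2[OF hs(4,5)] M1[OF hs(1,4)] M1[OF hs(2,4)] by simp
  then show ?thesis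
    using Mp[OF hs(1,2) M[OF hs(3,4,5)] eqs(1) 2(1)] Mp[OF M[OF hs(1,2,3)] hs(4,5) 2(2) eqs(4)] 1
    by simp
qed

end

end

theory Submission
  imports Defs
begin

text \<open>
  The whole theorem rests on reading a natural Mal'tsev operation on generalised elements: write
  \<open>M x y z\<close> for the composite of \<open>p\<^sub>X\<close> with the triple of three parallel morphisms \<open>x\<close>, \<open>y\<close>, \<open>z\<close> into
  \<open>X\<close>. The conditions on \<open>p\<close> say exactly that \<open>M\<close> is preserved by composition on both sides
  and satisfies \<open>M x y y = x\<close> and \<open>M y y z = z\<close> (\<open>naturally_maltsev_iff_operation\<close>). As \<open>M\<close>
  commutes with every morphism it commutes with itself, which makes it associative (\<open>M_assoc\<close>).

  Given \<open>M\<close>, the structures asked for can be written down. A reflexive graph is a groupoid with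
  \<open>x \<circ> y = M x (e d x) y\<close> and inverse \<open>M (e d x) x (e c x)\<close>, naturally in the graph. A span has the
  pregroupoid structure obtained by restricting \<open>M\<close>. For a relation \<open>(E, p\<^sub>1, p\<^sub>2)\<close> with
  commuting idempotents \<open>u = e\<^sub>1 p\<^sub>1\<close> and \<open>v = e\<^sub>2 p\<^sub>2\<close>, both projections identify
  \<open>M u (u v) v\<close> with the identity of \<open>E\<close>; so every \<open>m\<close> on \<open>E\<close> is determined by \<open>m e\<^sub>1\<close> and
  \<open>m e\<^sub>2\<close>, and the same formula gives its existence. Uniqueness of pregroupoid structures holds for
  the same reason, because \<open>(x, y, z) = M (x, y, y) (y, y, y) (y, y, z)\<close>. Admissibility of dikite
  diagrams is the special case of compatibility where the relation is the pullback of \<open>f\<close> and \<open>g\<close>.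

  Conversely, a pregroupoid structure on the span \<open>1 \<leftarrow> X \<rightarrow> 1\<close> is an operation on all triples. For
  categories and dikite diagrams the operation is found on the fibres of the second projection
  \<open>X \<times> X \<rightarrow> X\<close> with the diagonal as common section: an arrow over \<open>y\<close> is a pair \<open>(x, y)\<close>, the
  identity at \<open>y\<close> is \<open>(y, y)\<close>, all arrows over \<open>y\<close> are composable, and the unit laws for
  \<open>(x, y) \<circ> (z, y) = (M x y z, y)\<close> are the Mal'tsev identities
  (\<open>naturally_maltsev_if_fibrewise_unital\<close>). Functoriality of the section, respectively uniqueness
  in admissibility, gives naturality.
\<close>

section \<open>Equational reasoning with arrows, pullbacks and products\<close>

context category
begin

text \<open>The lemmas of this part restate the axioms with separate conditions on membership in \<open>Ar\<close>,
  source and target. Unlike membership in a hom set, these can be discharged by rewriting, without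
  guessing the intermediate objects, so that composites are brought to right-nested normal form
  by simplification.\<close>

lemma hom_iff: "f \<in> hom C X Y \<longleftrightarrow> f \<in> Ar C \<and> src C f = X \<and> tgt C f = Y"
  by (simp add: hom_def)

lemma cmp_Ar:
  assumes "f \<in> Ar C" "g \<in> Ar C" "src C g = tgt C f"
  shows "g \<cdot> f \<in> Ar C" "src C (g \<cdot> f) = src C f" "tgt C (g \<cdot> f) = tgt C g"
  using cmp_hom[OF ArD[OF assms(1)], of g "tgt C g"] ArD[OF assms(2)] assms(3) by (auto simp: hom_def)

lemma ident_Ar:
  assumes "X \<in> Ob C"
  shows "\<one> X \<in> Ar C" "src C (\<one> X) = X" "tgt C (\<one> X) = X"
  using ident_hom[OF assms] by (auto simp: hom_def)

lemma ident_cmp_Ar: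
  assumes "f \<in> Ar C"
  shows "tgt C f = Y \<Longrightarrow> \<one> Y \<cdot> f = f" "src C f = X \<Longrightarrow> f \<cdot> \<one> X = f"
  using ident_cmp[OF ArD[OF assms]] cmp_ident[OF ArD[OF assms]] by auto

lemma cmp_assoc_Ar:
  assumes "f \<in> Ar C" "g \<in> Ar C" "h \<in> Ar C" "src C g = tgt C f" "src C h = tgt C g"
  shows "(h \<cdot> g) \<cdot> f = h \<cdot> g \<cdot> f"
  by (rule cmp_assoc) (use assms in \<open>auto simp: hom_def\<close>)

lemmas arrow_simps = cmp_Ar ident_Ar ident_cmp_Ar cmp_assoc_Ar src_Ob tgt_Ob

text \<open>In right-nested normal form the left-hand side of an equation \<open>a \<cdot> b = c\<close> is no longer a
  subterm once something is composed on the right; this gives the version that still applies.\<close>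

lemma cmp_eq_cmp:
  assumes "a \<cdot> b = c" "a \<in> Ar C" "b \<in> Ar C" "src C a = tgt C b" "t \<in> Ar C" "tgt C t = src C b"
  shows "a \<cdot> b \<cdot> t = c \<cdot> t"
  using cmp_assoc_Ar[of t b a] assms by simp

lemma pb_Ar:
  assumes "has_pullback f g"
  shows "f \<in> Ar C" "g \<in> Ar C" "tgt C g = tgt C f" "pb1 f g \<in> Ar C" "pb2 f g \<in> Ar C"
    "src C (pb1 f g) = pb_ob f g" "src C (pb2 f g) = pb_ob f g"
    "tgt C (pb1 f g) = src C f" "tgt C (pb2 f g) = src C g" "f \<cdot> pb1 f g = g \<cdot> pb2 f g"
    "pb_ob f g \<in> Ob C"
  using pb_homs[OF assms] hom_Ob[OF pb_homs(4)[OF assms]] by (auto simp: hom_def)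

lemma pb_pair_Ar:
  assumes "has_pullback f g" "u \<in> Ar C" "v \<in> Ar C" "src C v = src C u"
    "tgt C u = src C f" "tgt C v = src C g" "f \<cdot> u = g \<cdot> v"
  shows "pb_pair f g u v \<in> Ar C" "src C (pb_pair f g u v) = src C u"
    "tgt C (pb_pair f g u v) = pb_ob f g"
    "pb1 f g \<cdot> pb_pair f g u v = u" "pb2 f g \<cdot> pb_pair f g u v = v"
    "\<lbrakk>t \<in> Ar C; tgt C t = src C u\<rbrakk> \<Longrightarrow> pb_pair f g u v \<cdot> t = pb_pair f g (u \<cdot> t) (v \<cdot> t)"
proof -
  have u: "u \<in> hom C (src C u) (src C f)" and v: "v \<in> hom C (src C u) (src C g)"
    using assms by (auto simp: hom_def)
  note p = pb_pair_props[OF assms(1) u v assms(7)]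
  show "pb_pair f g u v \<in> Ar C" "src C (pb_pair f g u v) = src C u"
    "tgt C (pb_pair f g u v) = pb_ob f g"
    "pb1 f g \<cdot> pb_pair f g u v = u" "pb2 f g \<cdot> pb_pair f g u v = v"
    using p by (auto simp: hom_def)
  show "pb_pair f g u v \<cdot> t = pb_pair f g (u \<cdot> t) (v \<cdot> t)" if "t \<in> Ar C" "tgt C t = src C u"
    using pb_pair_cmp[OF assms(1) u v assms(7), of t "src C t"] that by (simp add: hom_def)
qed

lemma pb_ext:
  assumes "has_pullback f g" "a \<in> hom C S (pb_ob f g)" "b \<in> hom C S (pb_ob f g)"
    "pb1 f g \<cdot> a = pb1 f g \<cdot> b" "pb2 f g \<cdot> a = pb2 f g \<cdot> b"
  shows "a = b"
  using pb_pair_eqI[OF assms(1,2)] pb_pair_eqI[OF assms(1,3)] assms(4,5) by metis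

lemma prod_is_product:
  assumes "has_binary_products" "X \<in> Ob C" "Y \<in> Ob C"
  shows "is_product X Y (pr1 X Y) (pr2 X Y)"
proof -
  obtain p q where "is_product X Y p q"
    using assms unfolding has_binary_products_def by blast
  then show ?thesis
    unfolding pr1_def pr2_def prod_def
    by (intro someI[where P = "\<lambda>pq. is_product X Y (fst pq) (snd pq)" and x = "(p, q)"]) simp
qed

lemma prod_Ar:
  assumes "has_binary_products" "X \<in> Ob C" "Y \<in> Ob C"
  shows "pr1 X Y \<in> Ar C" "pr2 X Y \<in> Ar C" "src C (pr1 X Y) = prod_ob X Y"
    "src C (pr2 X Y) = prod_ob X Y" "tgt C (pr1 X Y) = X" "tgt C (pr2 X Y) = Y"
    "prod_ob X Y \<in> Ob C"
  using prod_is_product[OF assms] src_Ob[of "pr1 X Y"]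
  by (auto simp: is_product_def prod_ob_def hom_def)

lemma prod_pair_Ar:
  assumes bp: "has_binary_products" and "u \<in> Ar C" "v \<in> Ar C" "src C v = src C u"
    "tgt C u = X" "tgt C v = Y"
  shows "prod_pair X Y u v \<in> Ar C" "src C (prod_pair X Y u v) = src C u"
    "tgt C (prod_pair X Y u v) = prod_ob X Y"
    "pr1 X Y \<cdot> prod_pair X Y u v = u" "pr2 X Y \<cdot> prod_pair X Y u v = v"
    "\<lbrakk>t \<in> Ar C; tgt C t = src C u\<rbrakk> \<Longrightarrow> prod_pair X Y u v \<cdot> t = prod_pair X Y (u \<cdot> t) (v \<cdot> t)"
proof -
  have XY: "X \<in> Ob C" "Y \<in> Ob C" using assms tgt_Ob by auto
  have ex1: "\<exists>!w. w \<in> hom C (src C u) (prod_ob X Y) \<and> pr1 X Y \<cdot> w = u \<and> pr2 X Y \<cdot> w = v"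
    if "u \<in> Ar C" "v \<in> Ar C" "src C v = src C u" "tgt C u = X" "tgt C v = Y" for u v
    using prod_is_product[OF bp XY] that unfolding is_product_def prod_ob_def hom_def by simp
  have P: "prod_pair X Y u v \<in> hom C (src C u) (prod_ob X Y)
      \<and> pr1 X Y \<cdot> prod_pair X Y u v = u \<and> pr2 X Y \<cdot> prod_pair X Y u v = v"
    if "u \<in> Ar C" "v \<in> Ar C" "src C v = src C u" "tgt C u = X" "tgt C v = Y" for u v
    unfolding prod_pair_def by (rule theI'[OF ex1[OF that]])
  show p: "prod_pair X Y u v \<in> Ar C" "src C (prod_pair X Y u v) = src C u"
    "tgt C (prod_pair X Y u v) = prod_ob X Y"
    "pr1 X Y \<cdot> prod_pair X Y u v = u" "pr2 X Y \<cdot> prod_pair X Y u v = v"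
    using P[OF assms(2-)] by (auto simp: hom_def)
  show "prod_pair X Y u v \<cdot> t = prod_pair X Y (u \<cdot> t) (v \<cdot> t)" if t: "t \<in> Ar C" "tgt C t = src C u"
  proof -
    note q = prod_Ar[OF bp XY]
    have "prod_pair X Y u v \<cdot> t \<in> hom C (src C (u \<cdot> t)) (prod_ob X Y)"
      "pr1 X Y \<cdot> prod_pair X Y u v \<cdot> t = u \<cdot> t" "pr2 X Y \<cdot> prod_pair X Y u v \<cdot> t = v \<cdot> t"
      using cmp_eq_cmp[OF p(4)] cmp_eq_cmp[OF p(5)] t p q assms
      by (simp_all add: arrow_simps hom_iff)
    moreover have uv: "u \<cdot> t \<in> Ar C" "v \<cdot> t \<in> Ar C" "src C (v \<cdot> t) = src C (u \<cdot> t)"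
      "tgt C (u \<cdot> t) = X" "tgt C (v \<cdot> t) = Y"
      using assms t by (simp_all add: arrow_simps)
    ultimately show ?thesis using ex1[OF uv] P[OF uv] by blast
  qed
qed

lemma triple_Ar:
  assumes bp: "has_binary_products"
    and "x \<in> Ar C" "y \<in> Ar C" "z \<in> Ar C" "src C y = src C x" "src C z = src C x"
    "tgt C x = X" "tgt C y = X" "tgt C z = X"
  shows "triple X x y z \<in> Ar C" "src C (triple X x y z) = src C x" "tgt C (triple X x y z) = cube X"
    "\<lbrakk>t \<in> Ar C; tgt C t = src C x\<rbrakk> \<Longrightarrow> triple X x y z \<cdot> t = triple X (x \<cdot> t) (y \<cdot> t) (z \<cdot> t)"
    "\<lbrakk>f \<in> Ar C; src C f = X; tgt C f = Y\<rbrakk>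
      \<Longrightarrow> cube_map X Y f \<cdot> triple X x y z = triple Y (f \<cdot> x) (f \<cdot> y) (f \<cdot> z)"
    "pr1 X X \<cdot> pr1 (prod_ob X X) X \<cdot> triple X x y z = x"
    "pr2 X X \<cdot> pr1 (prod_ob X X) X \<cdot> triple X x y z = y"
    "pr2 (prod_ob X X) X \<cdot> triple X x y z = z"
proof -
  have X: "X \<in> Ob C" using assms tgt_Ob by auto
  note pX = prod_Ar[OF bp X X]
  note s = assms X pX prod_Ar[OF bp pX(7) X] prod_pair_Ar[OF bp] arrow_simps
  show "triple X x y z \<in> Ar C" "src C (triple X x y z) = src C x" "tgt C (triple X x y z) = cube X"
    "\<lbrakk>t \<in> Ar C; tgt C t = src C x\<rbrakk> \<Longrightarrow> triple X x y z \<cdot> t = triple X (x \<cdot> t) (y \<cdot> t) (z \<cdot> t)"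
    "pr1 X X \<cdot> pr1 (prod_ob X X) X \<cdot> triple X x y z = x"
    "pr2 X X \<cdot> pr1 (prod_ob X X) X \<cdot> triple X x y z = y"
    "pr2 (prod_ob X X) X \<cdot> triple X x y z = z"
    by (simp_all add: triple_def cube_def s)
  show "\<lbrakk>f \<in> Ar C; src C f = X; tgt C f = Y\<rbrakk>
      \<Longrightarrow> cube_map X Y f \<cdot> triple X x y z = triple Y (f \<cdot> x) (f \<cdot> y) (f \<cdot> z)"
    by (simp add: cube_map_def triple_def cube_def s)
qed

end

section \<open>Natural Mal'tsev operations on generalised elements\<close>

text \<open>The object in which the operation takes place is the common target of the arguments, and
  therefore is not a parameter of \<open>M\<close>.\<close>

locale maltsev_operation = category C for C :: "('o, 'a) cat_data" (structure) +
  fixes M :: "'a \<Rightarrow> 'a \<Rightarrow> 'a \<Rightarrow> 'a"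
  assumes products: has_binary_products
    and M_hom: "\<lbrakk>x \<in> hom C S X; y \<in> hom C S X; z \<in> hom C S X\<rbrakk> \<Longrightarrow> M x y z \<in> hom C S X"
    and M_cmp: "\<lbrakk>x \<in> hom C S X; y \<in> hom C S X; z \<in> hom C S X; t \<in> hom C R S\<rbrakk>
      \<Longrightarrow> M x y z \<cdot> t = M (x \<cdot> t) (y \<cdot> t) (z \<cdot> t)"
    and M_natural: "\<lbrakk>x \<in> hom C S X; y \<in> hom C S X; z \<in> hom C S X; f \<in> hom C X Y\<rbrakk>
      \<Longrightarrow> f \<cdot> M x y z = M (f \<cdot> x) (f \<cdot> y) (f \<cdot> z)"
    and M_right_unit: "\<lbrakk>x \<in> hom C S X; y \<in> hom C S X\<rbrakk> \<Longrightarrow> M x y y = x"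
    and M_left_unit: "\<lbrakk>y \<in> hom C S X; z \<in> hom C S X\<rbrakk> \<Longrightarrow> M y y z = z"
begin

lemma M_Ar:
  assumes "x \<in> Ar C" "y \<in> Ar C" "z \<in> Ar C" "src C y = src C x" "src C z = src C x"
    "tgt C y = tgt C x" "tgt C z = tgt C x"
  shows "M x y z \<in> Ar C" "src C (M x y z) = src C x" "tgt C (M x y z) = tgt C x"
    "\<lbrakk>t \<in> Ar C; tgt C t = src C x\<rbrakk> \<Longrightarrow> M x y z \<cdot> t = M (x \<cdot> t) (y \<cdot> t) (z \<cdot> t)"
    "\<lbrakk>f \<in> Ar C; src C f = tgt C x\<rbrakk> \<Longrightarrow> f \<cdot> M x y z = M (f \<cdot> x) (f \<cdot> y) (f \<cdot> z)"
proof -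
  have h: "x \<in> hom C (src C x) (tgt C x)" "y \<in> hom C (src C x) (tgt C x)"
    "z \<in> hom C (src C x) (tgt C x)"
    using assms by (auto simp: hom_def)
  show "M x y z \<in> Ar C" "src C (M x y z) = src C x" "tgt C (M x y z) = tgt C x"
    using M_hom[OF h] by (auto simp: hom_def)
  show "M x y z \<cdot> t = M (x \<cdot> t) (y \<cdot> t) (z \<cdot> t)" if "t \<in> Ar C" "tgt C t = src C x"
    by (rule M_cmp[OF h]) (use that in \<open>auto simp: hom_def\<close>)
  show "f \<cdot> M x y z = M (f \<cdot> x) (f \<cdot> y) (f \<cdot> z)" if "f \<in> Ar C" "src C f = tgt C x"
    by (rule M_natural[OF h]) (use that in \<open>auto simp: hom_def\<close>)
qed

lemma M_units:
  assumes "x \<in> Ar C" "y \<in> Ar C" "src C y = src C x" "tgt C y = tgt C x"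
  shows "M x y y = x" "M x x y = y"
  using M_right_unit[of x "src C x" "tgt C x" y] M_left_unit[of x "src C x" "tgt C x" y] assms
  by (auto simp: hom_def)

text \<open>Naturality of \<open>M\<close> with respect to the morphism \<open>P = M \<pi>\<^sub>1 \<pi>\<^sub>2 \<pi>\<^sub>3\<close> from the cube of \<open>X\<close> to \<open>X\<close> says
  that \<open>M\<close> may be applied to the rows or to the columns of a \<open>3 \<times> 3\<close> matrix first. Associativity
  is this law for the matrix with rows \<open>(u, y, y)\<close>, \<open>(v, y, y)\<close>, \<open>(x, y, z)\<close>.\<close>

lemma M_assoc:
  assumes "u \<in> hom C S X" "v \<in> hom C S X" "x \<in> hom C S X" "y \<in> hom C S X" "z \<in> hom C S X"
  shows "M u v (M x y z) = M (M u v x) y z"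
proof -
  have X: "X \<in> Ob C" using hom_Ob[OF assms(1)] by simp
  note h = assms[unfolded hom_iff]
  note pX = prod_Ar[OF products X X]
  note s = h X pX prod_Ar[OF products pX(7) X] arrow_simps M_Ar
  note T = triple_Ar[OF products, where X = X]
  let ?\<pi>1 = "pr1 X X \<cdot> pr1 (prod_ob X X) X" and ?\<pi>2 = "pr2 X X \<cdot> pr1 (prod_ob X X) X"
    and ?\<pi>3 = "pr2 (prod_ob X X) X"
  let ?P = "M ?\<pi>1 ?\<pi>2 ?\<pi>3"
  let ?w = "M (triple X u y y) (triple X v y y) (triple X x y z)"
  have "?P \<cdot> ?w = M u v (M x y z)"
    by (subst M_Ar(5)) (simp_all add: s T cube_def M_units)
  moreover have "?P \<cdot> ?w = M (M u v x) y z"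
  proof -
    have "?\<pi>1 \<cdot> ?w = M u v x" "?\<pi>2 \<cdot> ?w = y" "?\<pi>3 \<cdot> ?w = z"
      by (simp_all add: s T cube_def M_units)
    then show ?thesis
      by (subst M_Ar(4)) (simp_all add: s T cube_def)
  qed
  ultimately show ?thesis by simp
qed

end

context category
begin

text \<open>This is the Yoneda argument: from the operation, the morphism \<open>p\<^sub>X\<close> is recovered by applying it
  to the three projections of the cube, which form the generic triple.\<close>

lemma naturally_maltsev_iff_operation:
  "naturally_maltsev \<longleftrightarrow> (\<exists>M. maltsev_operation C M)"
proof
  assume "naturally_maltsev"
  then obtain p where bp: "has_binary_products"
    and p: "\<And>X. X \<in> Ob C \<Longrightarrow> p X \<in> hom C (cube X) X"
      "\<And>X Y f. f \<in> hom C X Y \<Longrightarrow> f \<cdot> p X = p Y \<cdot> cube_map X Y f"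
      "\<And>S X x y. \<lbrakk>x \<in> hom C S X; y \<in> hom C S X\<rbrakk> \<Longrightarrow> p X \<cdot> triple X x y y = x"
      "\<And>S X y z. \<lbrakk>y \<in> hom C S X; z \<in> hom C S X\<rbrakk> \<Longrightarrow> p X \<cdot> triple X y y z = z"
    unfolding naturally_maltsev_def by metis
  define M where "M x y z = p (tgt C x) \<cdot> triple (tgt C x) x y z" for x y z
  note T = triple_Ar[OF bp]
  have pA: "p X \<in> Ar C" "src C (p X) = cube X" "tgt C (p X) = X" if "X \<in> Ob C" for X
    using p(1)[OF that] by (auto simp: hom_def)
  have "maltsev_operation C M"
  proof
    fix x y z S X assume "x \<in> hom C S X" "y \<in> hom C S X" "z \<in> hom C S X"
    note s = this[unfolded hom_iff]
    have X: "X \<in> Ob C" using s tgt_Ob by auto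
    note s = s X
    show "M x y z \<in> hom C S X"
      using s by (simp add: M_def arrow_simps T pA hom_iff)
    show "M x y z \<cdot> t = M (x \<cdot> t) (y \<cdot> t) (z \<cdot> t)" if "t \<in> hom C R S" for t R
      using s that[unfolded hom_iff] by (simp add: M_def arrow_simps T pA)
    show "f \<cdot> M x y z = M (f \<cdot> x) (f \<cdot> y) (f \<cdot> z)" if f: "f \<in> hom C X Y" for f Y
    proof -
      note s = s f[unfolded hom_iff] prod_Ar[OF bp X X] prod_Ar[OF bp prod_Ar(7)[OF bp X X] X]
      have Y: "Y \<in> Ob C" using s tgt_Ob by auto
      have c: "cube_map X Y f \<in> Ar C" "src C (cube_map X Y f) = cube X" "tgt C (cube_map X Y f) = cube Y"
        unfolding cube_map_def using s by (simp_all add: T arrow_simps) (simp add: cube_def)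
      have "f \<cdot> M x y z = (f \<cdot> p X) \<cdot> triple X x y z"
        using s by (simp add: M_def arrow_simps T pA)
      also have "\<dots> = p Y \<cdot> cube_map X Y f \<cdot> triple X x y z"
        unfolding p(2)[OF f] using s c Y by (subst cmp_assoc_Ar) (simp_all add: T pA)
      also have "\<dots> = M (f \<cdot> x) (f \<cdot> y) (f \<cdot> z)"
        using s by (simp add: T M_def arrow_simps)
      finally show ?thesis .
    qed
  next
    show "M x y y = x" if "x \<in> hom C S X" "y \<in> hom C S X" for x y S X
      using p(3)[OF that] that by (simp add: M_def hom_iff)
    show "M y y z = z" if "y \<in> hom C S X" "z \<in> hom C S X" for y z S X
      using p(4)[OF that] that by (simp add: M_def hom_iff)
  qed (rule bp)
  then show "\<exists>M. maltsev_operation C M" by blast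
next
  assume "\<exists>M. maltsev_operation C M"
  then obtain M where "maltsev_operation C M" by blast
  then interpret M: maltsev_operation C M .
  note bp = M.products
  define p where "p X = M (pr1 X X \<cdot> pr1 (prod_ob X X) X) (pr2 X X \<cdot> pr1 (prod_ob X X) X)
     (pr2 (prod_ob X X) X)" for X
  note T = triple_Ar[OF bp]
  have s: "pr1 X X \<cdot> pr1 (prod_ob X X) X \<in> hom C (cube X) X"
    "pr2 X X \<cdot> pr1 (prod_ob X X) X \<in> hom C (cube X) X" "pr2 (prod_ob X X) X \<in> hom C (cube X) X"
    if "X \<in> Ob C" for X
    using prod_Ar[OF bp that that] prod_Ar[OF bp prod_Ar(7)[OF bp that that] that] that
    by (auto simp: hom_iff arrow_simps cube_def)
  have pt: "p X \<cdot> triple X x y z = M x y z"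
    if "x \<in> hom C S X" "y \<in> hom C S X" "z \<in> hom C S X" for S X x y z
  proof -
    have X: "X \<in> Ob C" using hom_Ob[OF that(1)] by simp
    note q = prod_Ar[OF bp X X] prod_Ar[OF bp prod_Ar(7)[OF bp X X] X]
    have "triple X x y z \<in> hom C S (cube X)"
      using that by (simp add: T hom_iff)
    from M.M_cmp[OF s[OF X] this] show ?thesis
      using that X q by (simp add: p_def cmp_assoc_Ar T hom_iff cube_def)
  qed
  have "f \<cdot> p X = p Y \<cdot> cube_map X Y f" if f: "f \<in> hom C X Y" for X Y f
  proof -
    have X: "X \<in> Ob C" using hom_Ob[OF f] by simp
    note q = prod_Ar[OF bp X X] prod_Ar[OF bp prod_Ar(7)[OF bp X X] X]
    show ?thesis
      unfolding cube_map_def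
      using M.M_natural[OF s[OF X] f] pt[OF cmp_hom[OF s(1)[OF X] f] cmp_hom[OF s(2)[OF X] f]
          cmp_hom[OF s(3)[OF X] f]] by (simp add: p_def)
  qed
  moreover have "p X \<in> hom C (cube X) X" if "X \<in> Ob C" for X
    unfolding p_def using M.M_hom[OF s[OF that]] .
  ultimately show naturally_maltsev
    unfolding naturally_maltsev_def using bp pt M.M_left_unit M.M_right_unit by metis
qed

end

context category
begin

section \<open>Unital operations on the fibres of the second projection\<close>

definition diag :: "'o \<Rightarrow> 'a" where
  "diag X = prod_pair X X (\<one> X) (\<one> X)"

definition square_map :: "'o \<Rightarrow> 'o \<Rightarrow> 'a \<Rightarrow> 'a" where
  "square_map X Y f = prod_pair Y Y (f \<cdot> pr1 X X) (f \<cdot> pr2 X X)"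

abbreviation fibre_pairs :: "'o \<Rightarrow> 'o" where
  "fibre_pairs X \<equiv> pb_ob (pr2 X X) (pr2 X X)"

abbreviation fibre_pair :: "'o \<Rightarrow> 'a \<Rightarrow> 'a \<Rightarrow> 'a" where
  "fibre_pair X u v \<equiv> pb_pair (pr2 X X) (pr2 X X) u v"

abbreviation fibre_pr1 :: "'o \<Rightarrow> 'a" where "fibre_pr1 X \<equiv> pb1 (pr2 X X) (pr2 X X)"

abbreviation fibre_pr2 :: "'o \<Rightarrow> 'a" where "fibre_pr2 X \<equiv> pb2 (pr2 X X) (pr2 X X)"

lemma diag_Ar:
  assumes "has_binary_products" "X \<in> Ob C"
  shows "diag X \<in> Ar C" "src C (diag X) = X" "tgt C (diag X) = prod_ob X X"
    "pr1 X X \<cdot> diag X = \<one> X" "pr2 X X \<cdot> diag X = \<one> X"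
    "\<lbrakk>x \<in> Ar C; tgt C x = X\<rbrakk> \<Longrightarrow> diag X \<cdot> x = prod_pair X X x x"
  using assms by (simp_all add: diag_def prod_pair_Ar arrow_simps)

lemma square_map_Ar:
  assumes bp: "has_binary_products" and f: "f \<in> hom C X Y"
  shows "square_map X Y f \<in> Ar C" "src C (square_map X Y f) = prod_ob X X"
    "tgt C (square_map X Y f) = prod_ob Y Y"
    "pr1 Y Y \<cdot> square_map X Y f = f \<cdot> pr1 X X" "pr2 Y Y \<cdot> square_map X Y f = f \<cdot> pr2 X X"
    "\<lbrakk>u \<in> Ar C; v \<in> Ar C; src C v = src C u; tgt C u = X; tgt C v = X\<rbrakk>
      \<Longrightarrow> square_map X Y f \<cdot> prod_pair X X u v = prod_pair Y Y (f \<cdot> u) (f \<cdot> v)"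
proof -
  have "X \<in> Ob C" using hom_Ob[OF f] by simp
  note s = prod_Ar[OF bp this this] f[unfolded hom_iff]
  show "square_map X Y f \<in> Ar C" "src C (square_map X Y f) = prod_ob X X"
    "tgt C (square_map X Y f) = prod_ob Y Y"
    "pr1 Y Y \<cdot> square_map X Y f = f \<cdot> pr1 X X" "pr2 Y Y \<cdot> square_map X Y f = f \<cdot> pr2 X X"
    "\<lbrakk>u \<in> Ar C; v \<in> Ar C; src C v = src C u; tgt C u = X; tgt C v = X\<rbrakk>
      \<Longrightarrow> square_map X Y f \<cdot> prod_pair X X u v = prod_pair Y Y (f \<cdot> u) (f \<cdot> v)"
    by (simp_all add: square_map_def prod_pair_Ar[OF bp] s arrow_simps)
qed

lemma has_pullback_fibres:
  assumes "has_split_epi_pullbacks" "has_binary_products" "X \<in> Ob C"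
  shows "has_pullback (pr2 X X) (pr2 X X)"
proof -
  have "split_epi (pr2 X X)"
    unfolding split_epi_def using prod_Ar[OF assms(2,3,3)] diag_Ar[OF assms(2,3)]
    by (auto simp: hom_iff intro!: bexI[of _ "diag X"])
  then show ?thesis using assms(1) unfolding has_split_epi_pullbacks_def by blast
qed

text \<open>The operation is \<open>M x y z = q ((x, y), (z, y))\<close>. Restricting the two unit laws along \<open>(x, y)\<close>,
  respectively along \<open>(z, y)\<close>, yields \<open>q ((x, y), (y, y)) = x\<close> and \<open>q ((y, y), (z, y)) = z\<close>. The
  hypotheses have the shape in which both the unit laws of an internal category and the equations of
  an admissible dikite diagram present themselves.\<close>

lemma naturally_maltsev_if_fibrewise_unital:
  assumes E: "has_split_epi_pullbacks" and bp: "has_binary_products"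
    and q_hom: "\<And>X. X \<in> Ob C \<Longrightarrow> q X \<in> hom C (fibre_pairs X) X"
    and q_right: "\<And>X. X \<in> Ob C \<Longrightarrow>
      q X \<cdot> fibre_pair X (\<one> (prod_ob X X)) (diag X \<cdot> pr2 X X) = pr1 X X"
    and q_left: "\<And>X. X \<in> Ob C \<Longrightarrow>
      q X \<cdot> fibre_pair X (diag X \<cdot> pr2 X X) (\<one> (prod_ob X X)) = pr1 X X"
    and q_natural: "\<And>X Y f. f \<in> hom C X Y \<Longrightarrow>
      f \<cdot> q X = q Y \<cdot> fibre_pair Y (square_map X Y f \<cdot> fibre_pr1 X) (square_map X Y f \<cdot> fibre_pr2 X)"
  shows "naturally_maltsev"
  unfolding naturally_maltsev_iff_operation
proof
  define M where "M x y z = q (tgt C x)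
    \<cdot> fibre_pair (tgt C x) (prod_pair (tgt C x) (tgt C x) x y) (prod_pair (tgt C x) (tgt C x) z y)"
    for x y z
  have qA: "q X \<in> Ar C" "src C (q X) = fibre_pairs X" "tgt C (q X) = X" if "X \<in> Ob C" for X
    using q_hom[OF that] by (auto simp: hom_def)
  note pb = has_pullback_fibres[OF E bp]
  note P = pb_Ar(4-11)[OF pb] pb_pair_Ar[OF pb] prod_pair_Ar[OF bp] prod_Ar[OF bp] diag_Ar[OF bp]
  show "maltsev_operation C M"
  proof
    show "has_binary_products" by (rule bp)
  next
    fix x y z S X assume "x \<in> hom C S X" "y \<in> hom C S X" "z \<in> hom C S X"
    note s = this[unfolded hom_iff]
    have X: "X \<in> Ob C" using s tgt_Ob by auto
    note s = s X
    show "M x y z \<in> hom C S X"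
      by (simp add: s M_def arrow_simps P qA hom_iff)
    show "M x y z \<cdot> t = M (x \<cdot> t) (y \<cdot> t) (z \<cdot> t)" if "t \<in> hom C R S" for t R
      using that by (simp add: s hom_iff M_def arrow_simps P qA)
    show "f \<cdot> M x y z = M (f \<cdot> x) (f \<cdot> y) (f \<cdot> z)" if f: "f \<in> hom C X Y" for f Y
    proof -
      note k = square_map_Ar[OF bp f]
      note s = s f[unfolded hom_iff] k(1-3)
      have Y: "Y \<in> Ob C" using hom_Ob[OF f] by simp
      let ?t = "fibre_pair X (prod_pair X X x y) (prod_pair X X z y)"
      have t: "?t \<in> Ar C" "src C ?t = S" "tgt C ?t = fibre_pairs X"
        "fibre_pr1 X \<cdot> ?t = prod_pair X X x y" "fibre_pr2 X \<cdot> ?t = prod_pair X X z y"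
        by (simp_all add: s P arrow_simps)
      have e: "pr2 Y Y \<cdot> square_map X Y f \<cdot> fibre_pr1 X = pr2 Y Y \<cdot> square_map X Y f \<cdot> fibre_pr2 X"
        using cmp_eq_cmp[OF k(5), of "fibre_pr1 X"] cmp_eq_cmp[OF k(5), of "fibre_pr2 X"]
        by (simp add: s Y P arrow_simps)
      have "f \<cdot> M x y z = (f \<cdot> q X) \<cdot> ?t"
        by (simp add: s t M_def arrow_simps qA)
      also have "\<dots> = q Y \<cdot> fibre_pair Y (square_map X Y f \<cdot> fibre_pr1 X)
            (square_map X Y f \<cdot> fibre_pr2 X) \<cdot> ?t"
        unfolding q_natural[OF f] by (subst cmp_assoc_Ar) (simp_all add: s t Y e P qA arrow_simps)
      also have "\<dots> = M (f \<cdot> x) (f \<cdot> y) (f \<cdot> z)"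
        by (simp add: s e t Y k(6) P M_def arrow_simps)
      finally show ?thesis .
    qed
  next
    fix x y S X assume "x \<in> hom C S X" "y \<in> hom C S X"
    note s = this[unfolded hom_iff]
    have X: "X \<in> Ob C" using s tgt_Ob by auto
    note s = s X
    have r: "pr1 X X \<cdot> prod_pair X X x y = (q X \<cdot> fibre_pair X (\<one> (prod_ob X X)) (diag X \<cdot> pr2 X X)) \<cdot> prod_pair X X x y"
      unfolding q_right[OF X] ..
    show "M x y y = x"
      using r by (simp add: s M_def P qA arrow_simps)
    have l: "pr1 X X \<cdot> prod_pair X X y x = (q X \<cdot> fibre_pair X (diag X \<cdot> pr2 X X) (\<one> (prod_ob X X))) \<cdot> prod_pair X X y x"
      unfolding q_left[OF X] ..
    show "M x x y = y"
      using l by (simp add: s M_def P qA arrow_simps)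
  qed
qed

section \<open>Sections of the forgetful functors\<close>

lemma is_icat_truncate: "is_icat (icat.truncate G) = is_icat G"
  by (simp add: is_icat_def is_rgraph_def icat.truncate_def)

theorem Cat_section_if_Grpd_section:
  assumes E: "has_split_epi_pullbacks" and "Grpd_RG_has_section"
  shows "Cat_RG_has_section"
proof -
  obtain So Sa where F: "cat_functor RG Grpd So Sa"
    and S: "\<forall>X\<in>Ob RG. rgraph.truncate (So X) = X"
      "\<forall>f\<in>Ar RG. forget_ar rgraph.truncate (Sa f) = f"
    using assms(2) unfolding Grpd_RG_has_section_def has_section_def by blast
  interpret F: cat_functor RG Grpd So Sa by (rule F)
  have "cat_functor RG Cat (icat.truncate \<circ> So) (forget_ar icat.truncate \<circ> Sa)"
  proof (intro cat_functor.intro cat_functor_axioms.intro category_RG category_Cat[OF E])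
    show "(icat.truncate \<circ> So) X \<in> Ob Cat" if "X \<in> Ob RG" for X
      using F.Fo_Ob[OF that] by (simp add: Grpd_def Cat_def structure_cat_def is_igrpd_def is_icat_truncate)
    show "(forget_ar icat.truncate \<circ> Sa) f \<in> hom Cat ((icat.truncate \<circ> So) X) ((icat.truncate \<circ> So) Y)"
      if "f \<in> hom RG X Y" for f X Y
      using F.Fa_hom[OF that]
      by (auto simp: Grpd_def Cat_def structure_cat_def hom_def is_igrpd_mor_def is_icat_mor_def
          is_icat_truncate forget_ar_def is_rg_mor_def)
        (auto simp: is_rgraph_def icat.truncate_def)
    show "(forget_ar icat.truncate \<circ> Sa) (ident RG X) = ident Cat ((icat.truncate \<circ> So) X)"
      if "X \<in> Ob RG" for X
      using F.Fa_ident[OF that]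
      by (simp add: Grpd_def Cat_def structure_cat_def forget_ar_def icat.truncate_def)
    show "(forget_ar icat.truncate \<circ> Sa) (cmp RG g f)
        = cmp Cat ((forget_ar icat.truncate \<circ> Sa) g) ((forget_ar icat.truncate \<circ> Sa) f)"
      if "f \<in> hom RG X Y" "g \<in> hom RG Y Z" for f g X Y Z
      using F.Fa_cmp[OF that] by (simp add: Grpd_def Cat_def structure_cat_def forget_ar_def)
  qed
  moreover have "rgraph.truncate (icat.truncate G) = rgraph.truncate G" for G :: "('o, 'a) igrpd"
    by (simp add: rgraph.truncate_def icat.truncate_def)
  ultimately show ?thesis
    using S unfolding Cat_RG_has_section_def has_section_def
    by (intro exI[of _ "icat.truncate \<circ> So"] exI[of _ "forget_ar icat.truncate \<circ> Sa"])
      (simp add: forget_ar_def)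
qed

text \<open>The section is applied to the reflexive graph whose domain and codomain are both
  \<open>pr2\<close>, with the diagonal as identities: the first component of its multiplication is the
  required fibrewise operation. A morphism \<open>f\<close> induces the morphism of graphs \<open>(f \<times> f, f)\<close>, which
  the section sends to a functor; this gives naturality.\<close>

theorem naturally_maltsev_if_Cat_section:
  assumes E: "has_split_epi_pullbacks" and bp: "has_binary_products" and "Cat_RG_has_section"
  shows "naturally_maltsev"
proof -
  obtain So Sa where F: "cat_functor RG Cat So Sa"
    and S: "\<And>X. X \<in> Ob RG \<Longrightarrow> rgraph.truncate (So X) = X"
      "\<And>f. f \<in> Ar RG \<Longrightarrow> forget_ar rgraph.truncate (Sa f) = f"
    using assms(3) unfolding Cat_RG_has_section_def has_section_def by blast
  interpret F: cat_functor RG Cat So Sa by (rule F)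
  define G where "G X = \<lparr>C1 = prod_ob X X, C0 = X, gd = pr2 X X, ge = diag X, gc = pr2 X X\<rparr>" for X
  note pb = has_pullback_fibres[OF E bp]
  note P = pb_Ar(4-11)[OF pb] pb_pair_Ar[OF pb] prod_pair_Ar[OF bp] prod_Ar[OF bp] diag_Ar[OF bp]
  have G: "G X \<in> Ob RG" if "X \<in> Ob C" for X
    using that by (simp add: RG_def structure_cat_def is_rgraph_def G_def P hom_iff)
  define m where "m X = gm (So (G X))" for X
  have SG: "gd (So (G X)) = pr2 X X" "gc (So (G X)) = pr2 X X" "ge (So (G X)) = diag X"
    "C1 (So (G X)) = prod_ob X X" "C0 (So (G X)) = X" if "X \<in> Ob C" for X
    using S(1)[OF G[OF that]] by (simp_all add: rgraph.truncate_def G_def)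
  have "is_icat (So (G X))" if "X \<in> Ob C" for X
    using F.Fo_Ob[OF G[OF that]] by (simp add: Cat_def structure_cat_def)
  then have m: "m X \<in> Ar C" "src C (m X) = fibre_pairs X" "tgt C (m X) = prod_ob X X"
    "m X \<cdot> fibre_pair X (\<one> (prod_ob X X)) (diag X \<cdot> pr2 X X) = \<one> (prod_ob X X)"
    "m X \<cdot> fibre_pair X (diag X \<cdot> pr2 X X) (\<one> (prod_ob X X)) = \<one> (prod_ob X X)"
    if "X \<in> Ob C" for X
    using that by (auto simp: is_icat_def SG hom_iff m_def)
  show ?thesis
  proof (rule naturally_maltsev_if_fibrewise_unital[OF E bp, where q = "\<lambda>X. pr1 X X \<cdot> m X"])
    fix X assume X: "X \<in> Ob C"
    note s = X P m(1-3)[OF X] arrow_simps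
    show "pr1 X X \<cdot> m X \<in> hom C (fibre_pairs X) X" by (simp add: s hom_iff)
    show "(pr1 X X \<cdot> m X) \<cdot> fibre_pair X (\<one> (prod_ob X X)) (diag X \<cdot> pr2 X X) = pr1 X X"
      by (subst cmp_assoc_Ar) (simp_all only: m(4)[OF X], simp_all add: s)
    show "(pr1 X X \<cdot> m X) \<cdot> fibre_pair X (diag X \<cdot> pr2 X X) (\<one> (prod_ob X X)) = pr1 X X"
      by (subst cmp_assoc_Ar) (simp_all only: m(5)[OF X], simp_all add: s)
  next
    fix X Y f assume f: "f \<in> hom C X Y"
    have XY: "X \<in> Ob C" "Y \<in> Ob C" using hom_Ob[OF f] by auto
    note q = square_map_Ar[OF bp f]
    note s = f[unfolded hom_iff] q(1-3) XY P m(1-3)[OF XY(1)] m(1-3)[OF XY(2)] arrow_simps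
    let ?f = "GMor (G X) (G Y) (square_map X Y f) f"
    have "square_map X Y f \<cdot> diag X = diag Y \<cdot> f"
      using q(6)[of "\<one> X" "\<one> X"] by (simp add: s diag_def[of X])
    then have "is_rg_mor ?f"
      using G[OF XY(1)] G[OF XY(2)]
      by (simp add: is_rg_mor_def RG_def structure_cat_def) (simp add: G_def hom_iff s q(4,5))
    then have fh: "?f \<in> hom RG (G X) (G Y)" by (simp add: RG_def structure_cat_def hom_def)
    then have fA: "?f \<in> Ar RG" by (simp add: hom_def)
    have "is_icat_mor (Sa ?f)" "gsrc (Sa ?f) = So (G X)" "gtgt (Sa ?f) = So (G Y)"
      using F.Fa_hom[OF fh] by (auto simp: Cat_def structure_cat_def hom_def)
    moreover have "mor1 (Sa ?f) = square_map X Y f"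
      using S(2)[OF fA] by (simp add: forget_ar_def)
    ultimately have e: "square_map X Y f \<cdot> m X
        = m Y \<cdot> fibre_pair Y (square_map X Y f \<cdot> fibre_pr1 X) (square_map X Y f \<cdot> fibre_pr2 X)"
      by (simp add: is_icat_mor_def SG XY m_def)
    have e': "pr2 Y Y \<cdot> square_map X Y f \<cdot> fibre_pr1 X = pr2 Y Y \<cdot> square_map X Y f \<cdot> fibre_pr2 X"
      using cmp_eq_cmp[OF q(5), of "fibre_pr1 X"] cmp_eq_cmp[OF q(5), of "fibre_pr2 X"]
      by (simp add: s)
    have "f \<cdot> pr1 X X \<cdot> m X = pr1 Y Y \<cdot> square_map X Y f \<cdot> m X"
      using cmp_eq_cmp[OF q(4), of "m X"] by (simp add: s)
    then show "f \<cdot> pr1 X X \<cdot> m X = (pr1 Y Y \<cdot> m Y)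
        \<cdot> fibre_pair Y (square_map X Y f \<cdot> fibre_pr1 X) (square_map X Y f \<cdot> fibre_pr2 X)"
      by (simp add: s e e')
  qed
qed

lemma rgraph_Ar:
  assumes "is_rgraph G"
  shows "gd G \<in> Ar C" "src C (gd G) = C1 G" "tgt C (gd G) = C0 G"
    "gc G \<in> Ar C" "src C (gc G) = C1 G" "tgt C (gc G) = C0 G"
    "ge G \<in> Ar C" "src C (ge G) = C0 G" "tgt C (ge G) = C1 G"
    "C1 G \<in> Ob C" "C0 G \<in> Ob C"
    "gd G \<cdot> ge G = \<one> (C0 G)" "gc G \<cdot> ge G = \<one> (C0 G)"
    "\<lbrakk>t \<in> Ar C; tgt C t = C0 G\<rbrakk> \<Longrightarrow> gd G \<cdot> ge G \<cdot> t = t"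
    "\<lbrakk>t \<in> Ar C; tgt C t = C0 G\<rbrakk> \<Longrightarrow> gc G \<cdot> ge G \<cdot> t = t"
proof -
  show s: "gd G \<in> Ar C" "src C (gd G) = C1 G" "tgt C (gd G) = C0 G"
    "gc G \<in> Ar C" "src C (gc G) = C1 G" "tgt C (gc G) = C0 G"
    "ge G \<in> Ar C" "src C (ge G) = C0 G" "tgt C (ge G) = C1 G"
    "C1 G \<in> Ob C" "C0 G \<in> Ob C" and e: "gd G \<cdot> ge G = \<one> (C0 G)" "gc G \<cdot> ge G = \<one> (C0 G)"
    using assms rgraph_Ob[OF assms] by (auto simp: is_rgraph_def hom_iff)
  show "\<lbrakk>t \<in> Ar C; tgt C t = C0 G\<rbrakk> \<Longrightarrow> gd G \<cdot> ge G \<cdot> t = t"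
    "\<lbrakk>t \<in> Ar C; tgt C t = C0 G\<rbrakk> \<Longrightarrow> gc G \<cdot> ge G \<cdot> t = t"
    using cmp_eq_cmp[OF e(1), of t] cmp_eq_cmp[OF e(2), of t] s by (simp_all add: arrow_simps)
qed

end

context maltsev_operation
begin

text \<open>In an abelian group the operation is \<open>x - y + z\<close>, and these are the familiar formulas
  \<open>x - e d x + y\<close> for composition and \<open>e d x - x + e c x\<close> for the inverse.\<close>

definition maltsev_groupoid :: "('o, 'a) rgraph \<Rightarrow> ('o, 'a) igrpd" where
  "maltsev_groupoid G = \<lparr>C1 = C1 G, C0 = C0 G, gd = gd G, ge = ge G, gc = gc G,
     gm = M (pb1 (gd G) (gc G)) (ge G \<cdot> gd G \<cdot> pb1 (gd G) (gc G)) (pb2 (gd G) (gc G)),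
     gi = M (ge G \<cdot> gd G) (\<one> (C1 G)) (ge G \<cdot> gc G)\<rparr>"

lemma maltsev_groupoid_sel:
  "C1 (maltsev_groupoid G) = C1 G" "C0 (maltsev_groupoid G) = C0 G"
  "gd (maltsev_groupoid G) = gd G" "ge (maltsev_groupoid G) = ge G" "gc (maltsev_groupoid G) = gc G"
  by (simp_all add: maltsev_groupoid_def)

lemma maltsev_groupoid_mult:
  assumes E: "has_split_epi_pullbacks" and G: "is_rgraph G"
    and "x \<in> hom C S (C1 G)" "y \<in> hom C S (C1 G)" "gd G \<cdot> x = gc G \<cdot> y"
  shows "gm (maltsev_groupoid G) \<cdot> cpair G x y = M x (ge G \<cdot> gd G \<cdot> x) y"
proof -
  note pb = has_pullback_rgraph[OF E G]
  show ?thesis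
    using assms(3-)
    by (simp add: maltsev_groupoid_def hom_iff rgraph_Ar[OF G] pb_Ar[OF pb] pb_pair_Ar[OF pb]
        arrow_simps M_Ar)
qed

text \<open>The category and groupoid axioms are instances of associativity and of the Mal'tsev identities.
  For example \<open>x \<circ> x\<^sup>-\<^sup>1 = M x (e d x) (M (e d x) x (e c x)) = M (M x (e d x) (e d x)) x (e c x)
  = M x x (e c x) = e c x\<close>.\<close>

lemma maltsev_groupoid_is_igrpd:
  assumes E: "has_split_epi_pullbacks" and G: "is_rgraph G"
  shows "is_igrpd (maltsev_groupoid G)"
proof -
  note pb = has_pullback_rgraph[OF E G]
  note s = rgraph_Ar[OF G] arrow_simps M_Ar M_units
  note P = pb_Ar(4-11)[OF pb] pb_pair_Ar[OF pb]
  note mult = maltsev_groupoid_mult[OF E G]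
  let ?H = "maltsev_groupoid G"
  let ?i = "gi ?H" and ?d = "gd G" and ?c = "gc G" and ?e = "ge G" and ?\<mu> = "gm ?H"
  have i: "?i \<in> Ar C" "src C ?i = C1 G" "tgt C ?i = C1 G" "?d \<cdot> ?i = ?c" "?c \<cdot> ?i = ?d"
    by (simp_all add: maltsev_groupoid_def s)
  have \<mu>: "?\<mu> \<in> hom C (pb_ob ?d ?c) (C1 G)" "?d \<cdot> ?\<mu> = ?d \<cdot> pb2 ?d ?c" "?c \<cdot> ?\<mu> = ?c \<cdot> pb1 ?d ?c"
    by (simp_all add: maltsev_groupoid_def s P hom_iff)
  have assoc: "?\<mu> \<cdot> cpair G (?\<mu> \<cdot> cpair G x y) z = ?\<mu> \<cdot> cpair G x (?\<mu> \<cdot> cpair G y z)"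
    if h: "x \<in> hom C S (C1 G)" "y \<in> hom C S (C1 G)" "z \<in> hom C S (C1 G)"
      and e: "?d \<cdot> x = ?c \<cdot> y" "?d \<cdot> y = ?c \<cdot> z" for x y z S
  proof -
    note h' = h[unfolded hom_iff]
    have xy: "M x (?e \<cdot> ?d \<cdot> x) y \<in> hom C S (C1 G)" "?d \<cdot> M x (?e \<cdot> ?d \<cdot> x) y = ?d \<cdot> y"
      and yz: "M y (?e \<cdot> ?d \<cdot> y) z \<in> hom C S (C1 G)" "?c \<cdot> M y (?e \<cdot> ?d \<cdot> y) z = ?c \<cdot> y"
      and ed: "?e \<cdot> ?d \<cdot> x \<in> hom C S (C1 G)" "?e \<cdot> ?d \<cdot> y \<in> hom C S (C1 G)"
      using h' e by (simp_all add: s hom_iff)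
    have "?\<mu> \<cdot> cpair G (?\<mu> \<cdot> cpair G x y) z = M (M x (?e \<cdot> ?d \<cdot> x) y) (?e \<cdot> ?d \<cdot> y) z"
      using mult[OF xy(1) h(3)] xy e mult[OF h(1,2) e(1)] by simp
    also have "\<dots> = M x (?e \<cdot> ?d \<cdot> x) (M y (?e \<cdot> ?d \<cdot> y) z)"
      by (rule M_assoc[symmetric]) (rule h ed)+
    also have "\<dots> = ?\<mu> \<cdot> cpair G x (?\<mu> \<cdot> cpair G y z)"
      using mult[OF h(1) yz(1)] yz e mult[OF h(2,3) e(2)] by simp
    finally show ?thesis .
  qed
  have id: "\<one> (C1 G) \<in> hom C (C1 G) (C1 G)" and ih: "?i \<in> hom C (C1 G) (C1 G)"
    and ed: "?e \<cdot> ?d \<in> hom C (C1 G) (C1 G)" "?e \<cdot> ?c \<in> hom C (C1 G) (C1 G)"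
    using i by (simp_all add: hom_iff s)
  have units: "?\<mu> \<cdot> cpair G (\<one> (C1 G)) (?e \<cdot> ?d) = \<one> (C1 G)"
    "?\<mu> \<cdot> cpair G (?e \<cdot> ?c) (\<one> (C1 G)) = \<one> (C1 G)"
    using mult[OF id ed(1)] mult[OF ed(2) id] by (simp_all add: s)
  have "M (\<one> (C1 G)) (?e \<cdot> ?d) ?i = M (M (\<one> (C1 G)) (?e \<cdot> ?d) (?e \<cdot> ?d)) (\<one> (C1 G)) (?e \<cdot> ?c)"
    unfolding maltsev_groupoid_def igrpd.simps by (rule M_assoc) (rule id ed)+
  then have inv1: "?\<mu> \<cdot> cpair G (\<one> (C1 G)) ?i = ?e \<cdot> ?c"
    using mult[OF id ih] i by (simp add: s)
  have "M ?i (?e \<cdot> ?c) (\<one> (C1 G)) = M (?e \<cdot> ?d) (\<one> (C1 G)) (M (?e \<cdot> ?c) (?e \<cdot> ?c) (\<one> (C1 G)))"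
    unfolding maltsev_groupoid_def igrpd.simps by (rule M_assoc[symmetric]) (rule id ed)+
  then have inv2: "?\<mu> \<cdot> cpair G ?i (\<one> (C1 G)) = ?e \<cdot> ?d"
    using mult[OF ih id] i by (simp add: s)
  have "is_rgraph ?H" using G by (simp add: is_rgraph_def maltsev_groupoid_sel)
  then show ?thesis
    unfolding is_igrpd_def is_icat_def maltsev_groupoid_sel
    using \<mu> units assoc ih i(4,5) inv1 inv2 by blast
qed

text \<open>A morphism of reflexive graphs commutes with \<open>d\<close>, \<open>e\<close>, \<open>c\<close> and with \<open>M\<close>, hence with the composition
  and the inverse defined from them. The section therefore leaves the components of morphisms as they
  are, and its functoriality is immediate.\<close>

theorem Grpd_section:
  assumes E: "has_split_epi_pullbacks"
  shows "Grpd_RG_has_section"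
proof -
  let ?So = "maltsev_groupoid"
  let ?Sa = "\<lambda>f. GMor (?So (gsrc f)) (?So (gtgt f)) (mor1 f) (mor0 f)"
  have mor: "is_igrpd_mor (?Sa f)" if f: "is_rg_mor f" for f :: "(('o, 'a) rgraph, 'a) gmor"
  proof -
    define G H where GH: "G = gsrc f" "H = gtgt f"
    note f' = f[unfolded is_rg_mor_def, folded GH]
    have G: "is_rgraph G" "is_rgraph H" using f' by auto
    have fA: "mor1 f \<in> Ar C" "src C (mor1 f) = C1 G" "tgt C (mor1 f) = C1 H"
      "mor0 f \<in> Ar C" "src C (mor0 f) = C0 G" "tgt C (mor0 f) = C0 H"
      and eq: "gd H \<cdot> mor1 f = mor0 f \<cdot> gd G" "gc H \<cdot> mor1 f = mor0 f \<cdot> gc G"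
        "mor1 f \<cdot> ge G = ge H \<cdot> mor0 f"
      using f' by (auto simp: hom_iff)
    note pb = has_pullback_rgraph[OF E G(1)]
    note s = rgraph_Ar(1-11)[OF G(1)] rgraph_Ar(1-11)[OF G(2)] arrow_simps M_Ar pb_Ar[OF pb] fA
    let ?p = "pb1 (gd G) (gc G)" and ?q = "pb2 (gd G) (gc G)"
    have e: "gd H \<cdot> mor1 f \<cdot> t = mor0 f \<cdot> gd G \<cdot> t" "gc H \<cdot> mor1 f \<cdot> t = mor0 f \<cdot> gc G \<cdot> t"
      if "t \<in> Ar C" "tgt C t = C1 G" for t
      using cmp_eq_cmp[OF eq(1), of t] cmp_eq_cmp[OF eq(2), of t] that by (simp_all add: s)
    have e3: "mor1 f \<cdot> ge G \<cdot> t = ge H \<cdot> mor0 f \<cdot> t" if "t \<in> Ar C" "tgt C t = C0 G" for t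
      using cmp_eq_cmp[OF eq(3), of t] that by (simp add: s)
    have "mor1 f \<cdot> ?p \<in> hom C (pb_ob (gd G) (gc G)) (C1 H)"
      "mor1 f \<cdot> ?q \<in> hom C (pb_ob (gd G) (gc G)) (C1 H)"
      "gd H \<cdot> mor1 f \<cdot> ?p = gc H \<cdot> mor1 f \<cdot> ?q"
      using e[of ?p] e[of ?q] by (simp_all add: s hom_iff)
    note mult = maltsev_groupoid_mult[OF E G(2) this]
    have "mor1 f \<cdot> gm (?So G) = gm (?So H) \<cdot> cpair H (mor1 f \<cdot> ?p) (mor1 f \<cdot> ?q)"
      unfolding mult using e[of ?p] e3[of "gd G \<cdot> ?p"] by (simp add: maltsev_groupoid_def s)
    moreover have "mor1 f \<cdot> gi (?So G) = gi (?So H) \<cdot> mor1 f"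
      using e3[of "gd G"] e3[of "gc G"] eq(1,2) by (simp add: maltsev_groupoid_def s)
    moreover have "is_igrpd (?So G)" "is_igrpd (?So H)" using maltsev_groupoid_is_igrpd[OF E] G by auto
    moreover have "is_icat (?So G)" "is_icat (?So H)" "is_rgraph (?So G)" "is_rgraph (?So H)"
      using calculation(3,4) by (auto simp: is_igrpd_def is_icat_def)
    ultimately show ?thesis
      using f' unfolding is_igrpd_mor_def is_icat_mor_def is_rg_mor_def
      by (simp add: maltsev_groupoid_sel GH)
  qed
  have "cat_functor RG Grpd ?So ?Sa"
  proof (intro cat_functor.intro cat_functor_axioms.intro category_RG category_Grpd[OF E])
    show "?So X \<in> Ob Grpd" if "X \<in> Ob RG" for X
      using that maltsev_groupoid_is_igrpd[OF E] by (simp add: RG_def Grpd_def structure_cat_def)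
    show "?Sa f \<in> hom Grpd (?So X) (?So Y)" if "f \<in> hom RG X Y" for f X Y
      using that mor[of f] by (auto simp: RG_def Grpd_def structure_cat_def hom_def)
  qed (simp_all add: RG_def Grpd_def structure_cat_def maltsev_groupoid_sel hom_def)
  moreover have "rgraph.truncate (?So G) = G" for G
    by (simp add: rgraph.truncate_def maltsev_groupoid_def)
  ultimately show ?thesis
    unfolding Grpd_RG_has_section_def has_section_def
    by (intro exI[of _ ?So] exI[of _ ?Sa]) (simp add: forget_ar_def)
qed

section \<open>Compatibility of relations with spans\<close>

text \<open>With \<open>u = e\<^sub>1 p\<^sub>1\<close> and \<open>v = e\<^sub>2 p\<^sub>2\<close>, the solution is \<open>m = M (\<alpha> p\<^sub>1) (\<alpha> p\<^sub>1 v) (\<gamma> p\<^sub>2)\<close>, where the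
  middle term also equals \<open>\<gamma> p\<^sub>2 u\<close>; each required equation makes the middle term coincide with one
  of its neighbours.\<close>

theorem relations_compatible: "relations_compatible_with_spans"
  unfolding relations_compatible_with_spans_def compatible_def
proof (intro allI impI ballI, elim conjE)
  fix p1 p2 d c \<alpha> \<gamma> e1 e2
  assume rel: "is_relation p1 p2" and sp: "is_span d c"
    and "\<alpha> \<in> hom C (tgt C p1) (src C d)" "\<gamma> \<in> hom C (tgt C p2) (src C d)"
      "e1 \<in> hom C (tgt C p1) (src C p1)" "e2 \<in> hom C (tgt C p2) (src C p1)"
    and sec: "p1 \<cdot> e1 = \<one> (tgt C p1)" "p2 \<cdot> e2 = \<one> (tgt C p2)"
    and h1: "(e1 \<cdot> p1) \<cdot> e2 \<cdot> p2 = (e2 \<cdot> p2) \<cdot> e1 \<cdot> p1"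
    and h2: "(\<alpha> \<cdot> p1) \<cdot> e2 \<cdot> p2 = (\<gamma> \<cdot> p2) \<cdot> e1 \<cdot> p1"
    and h3: "d \<cdot> \<alpha> \<cdot> p1 = (d \<cdot> \<alpha> \<cdot> p1) \<cdot> e2 \<cdot> p2"
    and h4: "c \<cdot> \<gamma> \<cdot> p2 = (c \<cdot> \<gamma> \<cdot> p2) \<cdot> e1 \<cdot> p1"
  note h = this(3-6)[unfolded hom_iff]
  have A: "p1 \<in> Ar C" "p2 \<in> Ar C" "src C p2 = src C p1" "d \<in> Ar C" "c \<in> Ar C" "src C c = src C d"
    using rel sp by (auto simp: is_relation_def is_span_def)
  note s = h A arrow_simps M_Ar M_units
  have sec': "p1 \<cdot> e1 \<cdot> t = t" if "t \<in> Ar C" "tgt C t = tgt C p1" for t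
    using cmp_eq_cmp[OF sec(1), of t] that by (simp add: s)
  have sec'': "p2 \<cdot> e2 \<cdot> t = t" if "t \<in> Ar C" "tgt C t = tgt C p2" for t
    using cmp_eq_cmp[OF sec(2), of t] that by (simp add: s)
  note sec' = sec' sec''
  have k1: "e1 \<cdot> p1 \<cdot> e2 \<cdot> p2 = e2 \<cdot> p2 \<cdot> e1 \<cdot> p1" using h1 by (simp add: s)
  have k2: "\<alpha> \<cdot> p1 \<cdot> e2 \<cdot> p2 = \<gamma> \<cdot> p2 \<cdot> e1 \<cdot> p1" using h2 by (simp add: s)
  have k3: "d \<cdot> \<alpha> \<cdot> p1 \<cdot> e2 \<cdot> p2 = d \<cdot> \<alpha> \<cdot> p1" using h3 by (simp add: s)
  have k4: "c \<cdot> \<gamma> \<cdot> p2 \<cdot> e1 \<cdot> p1 = c \<cdot> \<gamma> \<cdot> p2" using h4 by (simp add: s)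
  have k5: "\<alpha> \<cdot> p1 \<cdot> e2 \<cdot> p2 \<cdot> e1 = \<gamma> \<cdot> p2 \<cdot> e1"
    using arg_cong[OF k2, of "\<lambda>t. t \<cdot> e1"] by (simp add: s sec)
  let ?m = "M (\<alpha> \<cdot> p1) (\<alpha> \<cdot> p1 \<cdot> e2 \<cdot> p2) (\<gamma> \<cdot> p2)"
  let ?E = "src C p1"
  show "\<exists>!m. m \<in> hom C ?E (src C d) \<and> m \<cdot> e1 = \<alpha> \<and> m \<cdot> e2 = \<gamma>
      \<and> d \<cdot> m = d \<cdot> \<gamma> \<cdot> p2 \<and> c \<cdot> m = c \<cdot> \<alpha> \<cdot> p1"
  proof (intro ex1I[of _ ?m] conjI)
    show "?m \<in> hom C ?E (src C d)" by (simp add: s hom_iff)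
    show "?m \<cdot> e1 = \<alpha>" by (simp add: s k5 sec)
    show "?m \<cdot> e2 = \<gamma>" by (simp add: s sec)
    show "d \<cdot> ?m = d \<cdot> \<gamma> \<cdot> p2" by (simp add: s k3)
    show "c \<cdot> ?m = c \<cdot> \<alpha> \<cdot> p1" by (simp add: s k2 k4)
  next
    fix m assume m: "m \<in> hom C ?E (src C d) \<and> m \<cdot> e1 = \<alpha> \<and> m \<cdot> e2 = \<gamma>
      \<and> d \<cdot> m = d \<cdot> \<gamma> \<cdot> p2 \<and> c \<cdot> m = c \<cdot> \<alpha> \<cdot> p1"
    \<comment> \<open>The identity of \<open>E\<close> is \<open>M u (u v) v\<close>, so \<open>m\<close> is determined by its composites with \<open>e1\<close> and \<open>e2\<close>.\<close>
    let ?w = "M (e1 \<cdot> p1) (e1 \<cdot> p1 \<cdot> e2 \<cdot> p2) (e2 \<cdot> p2)"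
    have w: "?w \<in> hom C ?E ?E" and i: "\<one> ?E \<in> hom C ?E ?E" by (simp_all add: s hom_iff)
    have "p1 \<cdot> ?w = p1 \<cdot> \<one> ?E" by (simp add: s sec')
    moreover have "p2 \<cdot> ?w = p2 \<cdot> \<one> ?E" by (simp add: s sec' k1)
    ultimately have "?w = \<one> ?E"
      using rel w i unfolding is_relation_def by blast
    then have "m = m \<cdot> ?w" using m by (simp add: hom_iff s)
    also have "\<dots> = M (m \<cdot> e1 \<cdot> p1) (m \<cdot> e1 \<cdot> p1 \<cdot> e2 \<cdot> p2) (m \<cdot> e2 \<cdot> p2)"
      using m by (simp add: hom_iff s)
    also have "\<dots> = ?m"
      using m cmp_eq_cmp[of m e1 \<alpha> p1] cmp_eq_cmp[of m e1 \<alpha> "p1 \<cdot> e2 \<cdot> p2"]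
        cmp_eq_cmp[of m e2 \<gamma> p2] by (simp add: hom_iff s)
    finally show "m = ?m" .
  qed
qed

section \<open>Pregroupoid structures on spans\<close>

text \<open>The structure is \<open>M\<close> restricted to the triples in the span. If \<open>r\<close> is any pregroupoid structure,
  then naturality of \<open>M\<close> with respect to \<open>r\<close>, applied to
  \<open>(x, y, z) = M (x, y, y) (y, y, y) (y, y, z)\<close>, gives \<open>r (x, y, z) = M x y z\<close>.\<close>

theorem canonical_pregroupoids_exist:
  assumes E: "has_split_epi_pullbacks"
  shows "spans_have_canonical_pregroupoids"
proof -
  define q1 where "q1 d c = pb1 d d \<cdot> pb1 (pb2 d d) (pb1 c c)" for d c
  define q2 where "q2 d c = pb2 d d \<cdot> pb1 (pb2 d d) (pb1 c c)" for d c
  define q3 where "q3 d c = pb2 c c \<cdot> pb2 (pb2 d d) (pb1 c c)" for d c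
  define p where "p d c = M (q1 d c) (q2 d c) (q3 d c)" for d c
  have q: "q1 d c \<in> Ar C" "src C (q1 d c) = span_ob d c" "tgt C (q1 d c) = src C d"
    "q2 d c \<in> Ar C" "src C (q2 d c) = span_ob d c" "tgt C (q2 d c) = src C d"
    "q3 d c \<in> Ar C" "src C (q3 d c) = span_ob d c" "tgt C (q3 d c) = src C d"
    "d \<cdot> q1 d c = d \<cdot> q2 d c" "c \<cdot> q2 d c = c \<cdot> q3 d c"
    "\<And>w. w \<in> Ar C \<Longrightarrow> tgt C w = span_ob d c \<Longrightarrow>
      q1 d c \<cdot> w = pb1 d d \<cdot> pb1 (pb2 d d) (pb1 c c) \<cdot> w \<and>
      q2 d c \<cdot> w = pb2 d d \<cdot> pb1 (pb2 d d) (pb1 c c) \<cdot> w \<and>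
      q3 d c \<cdot> w = pb2 c c \<cdot> pb2 (pb2 d d) (pb1 c c) \<cdot> w"
    if "is_span d c" for d c
  proof -
    note sp = span_props[OF E that]
    note s = pb_Ar[OF sp(1)] pb_Ar(1-9,11)[OF sp(2), unfolded sp(6)] pb_Ar(1-9,11)[OF sp(3)] arrow_simps
    show "q1 d c \<in> Ar C" "src C (q1 d c) = span_ob d c" "tgt C (q1 d c) = src C d"
      "q2 d c \<in> Ar C" "src C (q2 d c) = span_ob d c" "tgt C (q2 d c) = src C d"
      "q3 d c \<in> Ar C" "src C (q3 d c) = span_ob d c" "tgt C (q3 d c) = src C d"
      "\<And>w. w \<in> Ar C \<Longrightarrow> tgt C w = span_ob d c \<Longrightarrow>
        q1 d c \<cdot> w = pb1 d d \<cdot> pb1 (pb2 d d) (pb1 c c) \<cdot> w \<and>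
        q2 d c \<cdot> w = pb2 d d \<cdot> pb1 (pb2 d d) (pb1 c c) \<cdot> w \<and>
        q3 d c \<cdot> w = pb2 c c \<cdot> pb2 (pb2 d d) (pb1 c c) \<cdot> w"
      by (simp_all add: q1_def q2_def q3_def span_ob_def s)
    show "d \<cdot> q1 d c = d \<cdot> q2 d c"
      using cmp_eq_cmp[OF pb_Ar(10)[OF sp(1)], of "pb1 (pb2 d d) (pb1 c c)"]
      by (simp add: q1_def q2_def s)
    show "c \<cdot> q2 d c = c \<cdot> q3 d c"
      using cmp_eq_cmp[OF pb_Ar(10)[OF sp(2)], of "pb2 (pb2 d d) (pb1 c c)"] pb_Ar(10)[OF sp(3)] sp(6)
      by (simp add: q2_def q3_def s)
  qed
  have tr: "span_triple d c x y z \<in> hom C S (span_ob d c)" "q1 d c \<cdot> span_triple d c x y z = x"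
    "q2 d c \<cdot> span_triple d c x y z = y" "q3 d c \<cdot> span_triple d c x y z = z"
    if "is_span d c" "x \<in> hom C S (src C d)" "y \<in> hom C S (src C d)" "z \<in> hom C S (src C d)"
      "d \<cdot> x = d \<cdot> y" "c \<cdot> y = c \<cdot> z" for d c S x y z
    using span_triple_props(1,4-6)[OF E that] q(12)[OF that(1), of "span_triple d c x y z"]
    by (simp_all add: hom_iff)
  have ps: "p d c \<cdot> span_triple d c x y z = M x y z"
    if "is_span d c" "x \<in> hom C S (src C d)" "y \<in> hom C S (src C d)" "z \<in> hom C S (src C d)"
      "d \<cdot> x = d \<cdot> y" "c \<cdot> y = c \<cdot> z" for d c S x y z
    using tr[OF that] q[OF that(1)] by (simp add: p_def M_Ar hom_iff)
  have pg: "is_pregroupoid d c (p d c)" if sp: "is_span d c" for d c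
  proof -
    have A: "d \<in> Ar C" "c \<in> Ar C" "src C c = src C d" using sp by (auto simp: is_span_def)
    have "p d c \<in> hom C (span_ob d c) (src C d)"
      using q[OF sp] by (simp add: p_def M_Ar hom_iff)
    moreover have "d \<cdot> p d c \<cdot> span_triple d c x y z = d \<cdot> z"
      "c \<cdot> p d c \<cdot> span_triple d c x y z = c \<cdot> x"
      if h: "x \<in> hom C S (src C d)" "y \<in> hom C S (src C d)" "z \<in> hom C S (src C d)"
        and e: "d \<cdot> x = d \<cdot> y" "c \<cdot> y = c \<cdot> z" for S x y z
      unfolding ps[OF sp h e] using h e A by (simp_all add: M_Ar M_units arrow_simps hom_iff)
    moreover have "p d c \<cdot> span_triple d c x y y = x"
      if "x \<in> hom C S (src C d)" "y \<in> hom C S (src C d)" "d \<cdot> x = d \<cdot> y" for S x y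
      using ps[OF sp that(1,2,2,3) refl] M_right_unit[OF that(1,2)] by simp
    moreover have "p d c \<cdot> span_triple d c y y z = z"
      if "y \<in> hom C S (src C d)" "z \<in> hom C S (src C d)" "c \<cdot> y = c \<cdot> z" for S y z
      using ps[OF sp that(1,1,2) refl that(3)] M_left_unit[OF that(1,2)] by simp
    ultimately show ?thesis unfolding is_pregroupoid_def by blast
  qed
  have uniq: "r = p d c" if sp: "is_span d c" and r: "is_pregroupoid d c r" for d c r
  proof -
    note h = q[OF sp]
    let ?x = "q1 d c" and ?y = "q2 d c" and ?z = "q3 d c"
    have xyz: "?x \<in> hom C (span_ob d c) (src C d)" "?y \<in> hom C (span_ob d c) (src C d)"
      "?z \<in> hom C (span_ob d c) (src C d)"
      using h by (auto simp: hom_iff)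
    have rA: "r \<in> Ar C" "src C r = span_ob d c" "tgt C r = src C d"
      using pregroupoidD(1)[OF r] by (auto simp: hom_iff)
    have Ob: "span_ob d c \<in> Ob C" using hom_Ob[OF xyz(1)] by simp
    note t1 = tr[OF sp xyz(1,2,2) h(10) refl, unfolded hom_iff]
      and t2 = tr[OF sp xyz(2,2,2) refl refl, unfolded hom_iff]
      and t3 = tr[OF sp xyz(2,2,3) refl h(11), unfolded hom_iff]
    \<comment> \<open>The generic triple of the span, decomposed into triples on which every pregroupoid structure is known.\<close>
    let ?w = "M (span_triple d c ?x ?y ?y) (span_triple d c ?y ?y ?y) (span_triple d c ?y ?y ?z)"
    have w: "?w \<in> hom C (span_ob d c) (span_ob d c)"
      using t1 t2 t3 by (simp add: M_Ar hom_iff)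
    have "?x \<cdot> ?w = ?x" "?y \<cdot> ?w = ?y" "?z \<cdot> ?w = ?z"
      using t1 t2 t3 h by (simp_all add: M_Ar M_units)
    then have "?w = span_triple d c ?x ?y ?z"
      using h(12)[of ?w] w by (intro span_triple_props(3)[OF E sp xyz h(10,11)]) (auto simp: hom_iff)
    moreover have "\<one> (span_ob d c) = span_triple d c ?x ?y ?z"
      using h(12)[of "\<one> (span_ob d c)"] ident_hom[OF Ob] h Ob
      by (intro span_triple_props(3)[OF E sp xyz h(10,11)]) (auto simp: arrow_simps)
    ultimately have "r = r \<cdot> ?w" using ident_cmp_Ar(2)[OF rA(1,2)] by simp
    also have "\<dots> = M (r \<cdot> span_triple d c ?x ?y ?y) (r \<cdot> span_triple d c ?y ?y ?y)
        (r \<cdot> span_triple d c ?y ?y ?z)"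
      using t1 t2 t3 rA by (simp add: M_Ar)
    also have "\<dots> = p d c"
      using pregroupoidD(4)[OF r xyz(1,2) h(10)] pregroupoidD(4)[OF r xyz(2,2) refl]
        pregroupoidD(5)[OF r xyz(2,3) h(11)] by (simp add: p_def)
    finally show ?thesis .
  qed
  have "natural_pregroupoids p"
    unfolding natural_pregroupoids_def
  proof (intro allI impI ballI, elim conjE)
    fix d c d' c' f f0 f1 S x y z
    assume sp: "is_span d c" "is_span d' c'"
      and f: "f \<in> hom C (src C d) (src C d')" "f0 \<in> hom C (tgt C d) (tgt C d')"
        "f1 \<in> hom C (tgt C c) (tgt C c')"
      and eq: "d' \<cdot> f = f0 \<cdot> d" "c' \<cdot> f = f1 \<cdot> c"
      and xyz: "x \<in> hom C S (src C d)" "y \<in> hom C S (src C d)" "z \<in> hom C S (src C d)"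
      and e: "d \<cdot> x = d \<cdot> y" "c \<cdot> y = c \<cdot> z"
    have A: "d \<in> Ar C" "c \<in> Ar C" "src C c = src C d" "d' \<in> Ar C" "c' \<in> Ar C" "src C c' = src C d'"
      using sp by (auto simp: is_span_def)
    note s = A f[unfolded hom_iff] xyz[unfolded hom_iff] arrow_simps
    have "d' \<cdot> f \<cdot> t = f0 \<cdot> d \<cdot> t" "c' \<cdot> f \<cdot> t = f1 \<cdot> c \<cdot> t" if "t \<in> hom C S (src C d)" for t
      using cmp_eq_cmp[OF eq(1), of t] cmp_eq_cmp[OF eq(2), of t] that by (simp_all add: s hom_iff)
    then have e': "d' \<cdot> f \<cdot> x = d' \<cdot> f \<cdot> y" "c' \<cdot> f \<cdot> y = c' \<cdot> f \<cdot> z"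
      using xyz e by simp_all
    have "p d' c' \<cdot> span_triple d' c' (f \<cdot> x) (f \<cdot> y) (f \<cdot> z) = M (f \<cdot> x) (f \<cdot> y) (f \<cdot> z)"
      by (rule ps[OF sp(2) cmp_hom[OF xyz(1) f(1)] cmp_hom[OF xyz(2) f(1)] cmp_hom[OF xyz(3) f(1)] e'])
    then show "f \<cdot> p d c \<cdot> span_triple d c x y z
        = p d' c' \<cdot> span_triple d' c' (f \<cdot> x) (f \<cdot> y) (f \<cdot> z)"
      using ps[OF sp(1) xyz e] M_natural[OF xyz f(1)] by simp
  qed
  then show ?thesis
    unfolding spans_have_canonical_pregroupoids_def canonical_pregroupoids_def using pg uniq by blast
qed

end

context category
begin

section \<open>Dikite diagrams\<close>

text \<open>The pullback of two split epimorphisms \<open>f\<close> and \<open>g\<close> is a relation between their domains: its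
  projections are jointly monic, and they admit kernel pairs because they are split by
  \<open>e\<^sub>1 a = (a, s f a)\<close> and \<open>e\<^sub>2 b = (r g b, b)\<close>. Both composites of the idempotents send \<open>(a, b)\<close> to
  \<open>(r y, s y)\<close> with \<open>y = f a = g b\<close>, and the dikite equations become the hypotheses of compatibility.\<close>

theorem dikites_admissible_if_relations_compatible:
  assumes E: "has_split_epi_pullbacks" and "relations_compatible_with_spans"
  shows "dikites_admissible"
  unfolding dikites_admissible_def
proof (intro allI impI)
  fix f r g s \<alpha> \<beta> \<gamma> d c
  assume dk: "is_dikite f r g s \<alpha> \<beta> \<gamma> d c"
  then have A: "f \<in> Ar C" "g \<in> Ar C" "tgt C g = tgt C f" "r \<in> Ar C" "src C r = tgt C f"
      "tgt C r = src C f" "s \<in> Ar C" "src C s = tgt C f" "tgt C s = src C g"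
      "\<alpha> \<in> Ar C" "src C \<alpha> = src C f" "tgt C \<alpha> = src C d" "\<beta> \<in> Ar C" "src C \<beta> = tgt C f"
      "tgt C \<beta> = src C d" "\<gamma> \<in> Ar C" "src C \<gamma> = src C g" "tgt C \<gamma> = src C d"
      "d \<in> Ar C" "c \<in> Ar C" "src C c = src C d"
    and eq: "f \<cdot> r = \<one> (tgt C f)" "g \<cdot> s = \<one> (tgt C f)" "\<alpha> \<cdot> r = \<beta>" "\<gamma> \<cdot> s = \<beta>"
      "d \<cdot> \<alpha> = d \<cdot> \<beta> \<cdot> f" "c \<cdot> \<gamma> = c \<cdot> \<beta> \<cdot> g"
    and sp: "is_span d c"
    unfolding is_dikite_def is_span_def by (auto simp: hom_iff)
  have "split_epi f" "split_epi g"
    using A eq unfolding split_epi_def by (auto simp: hom_iff)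
  then have pb: "has_pullback f g"
    using E A unfolding has_split_epi_pullbacks_def by metis
  note S = A pb_Ar(4-9,11)[OF pb] pb_pair_Ar[OF pb] arrow_simps
  have eq': "f \<cdot> r \<cdot> t = t" "g \<cdot> s \<cdot> t = t" "\<alpha> \<cdot> r \<cdot> t = \<beta> \<cdot> t" "\<gamma> \<cdot> s \<cdot> t = \<beta> \<cdot> t"
    if "t \<in> Ar C" "tgt C t = tgt C f" for t
    using cmp_eq_cmp[OF eq(1), of t] cmp_eq_cmp[OF eq(2), of t] cmp_eq_cmp[OF eq(3), of t]
      cmp_eq_cmp[OF eq(4), of t] that by (simp_all add: S)
  have eq'': "d \<cdot> \<alpha> \<cdot> t = d \<cdot> \<beta> \<cdot> f \<cdot> t" if "t \<in> Ar C" "tgt C t = src C f" for t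
    using cmp_eq_cmp[OF eq(5), of t] that by (simp add: S)
  have eq''': "c \<cdot> \<gamma> \<cdot> t = c \<cdot> \<beta> \<cdot> g \<cdot> t" if "t \<in> Ar C" "tgt C t = src C g" for t
    using cmp_eq_cmp[OF eq(6), of t] that by (simp add: S)
  let ?p = "pb1 f g" and ?q = "pb2 f g"
  let ?e1 = "pb_pair f g (\<one> (src C f)) (s \<cdot> f)" and ?e2 = "pb_pair f g (r \<cdot> g) (\<one> (src C g))"
  have e: "?e1 \<in> Ar C" "src C ?e1 = src C f" "tgt C ?e1 = pb_ob f g"
    "?p \<cdot> ?e1 = \<one> (src C f)" "?q \<cdot> ?e1 = s \<cdot> f"
    "?e2 \<in> Ar C" "src C ?e2 = src C g" "tgt C ?e2 = pb_ob f g"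
    "?p \<cdot> ?e2 = r \<cdot> g" "?q \<cdot> ?e2 = \<one> (src C g)"
    by (simp_all add: S eq')
  have e1t: "?p \<cdot> ?e1 \<cdot> t = t" "?q \<cdot> ?e1 \<cdot> t = s \<cdot> f \<cdot> t" if "t \<in> Ar C" "tgt C t = src C f" for t
    using cmp_eq_cmp[OF e(4), of t] cmp_eq_cmp[OF e(5), of t] that
    by (simp_all add: A e arrow_simps pb_Ar(4-9,11)[OF pb])
  have e2t: "?p \<cdot> ?e2 \<cdot> t = r \<cdot> g \<cdot> t" "?q \<cdot> ?e2 \<cdot> t = t" if "t \<in> Ar C" "tgt C t = src C g" for t
    using cmp_eq_cmp[OF e(9), of t] cmp_eq_cmp[OF e(10), of t] that
    by (simp_all add: A e arrow_simps pb_Ar(4-9,11)[OF pb])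
  have rel: "is_relation ?p ?q"
  proof -
    have "split_epi ?p" "split_epi ?q"
      using e pb_Ar(4-9)[OF pb] unfolding split_epi_def by (auto simp: hom_iff)
    then have "is_span ?p ?q"
      using E pb_Ar(4-9)[OF pb] unfolding is_span_def has_split_epi_pullbacks_def by simp
    then show ?thesis
      unfolding is_relation_def using pb_ext[OF pb] pb_Ar(6)[OF pb] by auto
  qed
  have "(?e1 \<cdot> ?p) \<cdot> ?e2 \<cdot> ?q = (?e2 \<cdot> ?q) \<cdot> ?e1 \<cdot> ?p"
  proof (rule pb_ext[OF pb])
    show "(?e1 \<cdot> ?p) \<cdot> ?e2 \<cdot> ?q \<in> hom C (pb_ob f g) (pb_ob f g)"
      "(?e2 \<cdot> ?q) \<cdot> ?e1 \<cdot> ?p \<in> hom C (pb_ob f g) (pb_ob f g)"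
      using e A pb_Ar(4-9,11)[OF pb] by (simp_all add: cmp_Ar hom_iff)
    note F = A pb_Ar(4-11)[OF pb] arrow_simps e e1t e2t eq'
    show "?p \<cdot> (?e1 \<cdot> ?p) \<cdot> ?e2 \<cdot> ?q = ?p \<cdot> (?e2 \<cdot> ?q) \<cdot> ?e1 \<cdot> ?p"
      by (simp add: F)
    show "?q \<cdot> (?e1 \<cdot> ?p) \<cdot> ?e2 \<cdot> ?q = ?q \<cdot> (?e2 \<cdot> ?q) \<cdot> ?e1 \<cdot> ?p"
      by (simp add: F)
  qed
  moreover
  note F = A pb_Ar(4-9,11)[OF pb] arrow_simps e e1t e2t eq' eq'' eq'''
  have "(\<alpha> \<cdot> ?p) \<cdot> ?e2 \<cdot> ?q = (\<gamma> \<cdot> ?q) \<cdot> ?e1 \<cdot> ?p"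
    using pb_Ar(10)[OF pb] by (simp add: F)
  moreover have "d \<cdot> \<alpha> \<cdot> ?p = (d \<cdot> \<alpha> \<cdot> ?p) \<cdot> ?e2 \<cdot> ?q"
    using pb_Ar(10)[OF pb] by (simp add: F)
  moreover have "c \<cdot> \<gamma> \<cdot> ?q = (c \<cdot> \<gamma> \<cdot> ?q) \<cdot> ?e1 \<cdot> ?p"
    using pb_Ar(10)[OF pb] by (simp add: F)
  moreover have "compatible ?p ?q d c"
    using assms(2) rel sp unfolding relations_compatible_with_spans_def by blast
  ultimately show "admissible f r g s \<alpha> \<gamma> d c"
    unfolding compatible_def admissible_def
    by (auto simp: hom_iff A pb_Ar(4-9,11)[OF pb] e)
qed

text \<open>For \<open>k\<close> from \<open>X\<close> to \<open>Y\<close>, admissibility is applied to the dikite diagram with \<open>f = g = pr2\<close>,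
  \<open>r = s = diag\<close>, \<open>\<alpha> = \<gamma> = k \<cdot> pr1\<close> and \<open>\<beta> = k\<close>, with direction the span of two copies of the
  morphism to the terminal object, which makes all conditions on \<open>d\<close> and \<open>c\<close> void. The case \<open>k = 1\<close>
  defines the fibrewise operation \<open>q\<close>. In the case \<open>k = f\<close>, both sides of the naturality square of \<open>q\<close>
  at \<open>f\<close> are solutions, hence equal.\<close>

theorem naturally_maltsev_if_dikites_admissible:
  assumes E: "has_split_epi_pullbacks" and fp: "has_finite_products" and "dikites_admissible"
  shows "naturally_maltsev"
proof -
  obtain T where T: "is_terminal T" and bp: "has_binary_products"
    using fp by (auto simp: has_finite_products_def)
  note pb = has_pullback_fibres[OF E bp]
  note P = pb_Ar(4-11)[OF pb] prod_pair_Ar[OF bp] prod_Ar[OF bp] diag_Ar[OF bp]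
  let ?R = "\<lambda>X. fibre_pair X (\<one> (prod_ob X X)) (diag X \<cdot> pr2 X X)"
  let ?L = "\<lambda>X. fibre_pair X (diag X \<cdot> pr2 X X) (\<one> (prod_ob X X))"
  have sol: "\<exists>!m. m \<in> hom C (fibre_pairs X) Y \<and> m \<cdot> ?R X = k \<cdot> pr1 X X \<and> m \<cdot> ?L X = k \<cdot> pr1 X X"
    if k: "k \<in> hom C X Y" for X Y k
  proof -
    have XY: "X \<in> Ob C" "Y \<in> Ob C" using hom_Ob[OF k] by auto
    obtain b where b: "b \<in> hom C Y T" using T XY unfolding is_terminal_def by blast
    note s = P XY k[unfolded hom_iff] b[unfolded hom_iff] arrow_simps
    have bt: "u = v" if "u \<in> hom C S T" "v \<in> hom C S T" for u v S
      using T hom_Ob[OF that(1)] that unfolding is_terminal_def by blast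
    have "is_dikite (pr2 X X) (diag X) (pr2 X X) (diag X) (k \<cdot> pr1 X X) k (k \<cdot> pr1 X X) b b"
      unfolding is_dikite_def
      using terminal_span[OF T bp b] bt[of "b \<cdot> k \<cdot> pr1 X X" "prod_ob X X" "b \<cdot> k \<cdot> pr2 X X"]
      by (simp add: s hom_iff)
    then have adm: "admissible (pr2 X X) (diag X) (pr2 X X) (diag X) (k \<cdot> pr1 X X) (k \<cdot> pr1 X X) b b"
      using assms(3) unfolding dikites_admissible_def by blast
    have legs: "b \<cdot> m = b \<cdot> (k \<cdot> pr1 X X) \<cdot> t"
      if "m \<in> hom C (fibre_pairs X) Y" "t \<in> hom C (fibre_pairs X) (prod_ob X X)" for m t
      using that by (intro bt[of _ "fibre_pairs X"]) (simp_all add: s hom_iff)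
    have "fibre_pr1 X \<in> hom C (fibre_pairs X) (prod_ob X X)"
      "fibre_pr2 X \<in> hom C (fibre_pairs X) (prod_ob X X)" by (simp_all add: s hom_iff)
    note legs = legs[OF _ this(1)] legs[OF _ this(2)]
    have "src C (pr2 X X) = prod_ob X X" "src C b = Y" by (simp_all add: s)
    then show ?thesis
      using adm legs unfolding admissible_def by (metis (no_types, lifting))
  qed
  define q where "q X = (THE m. m \<in> hom C (fibre_pairs X) X
    \<and> m \<cdot> ?R X = \<one> X \<cdot> pr1 X X \<and> m \<cdot> ?L X = \<one> X \<cdot> pr1 X X)" for X
  have q: "q X \<in> hom C (fibre_pairs X) X" "q X \<cdot> ?R X = pr1 X X" "q X \<cdot> ?L X = pr1 X X"
    if "X \<in> Ob C" for X
    using theI'[OF sol[OF ident_hom[OF that]], folded q_def] that by (simp_all add: P arrow_simps)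
  show ?thesis
  proof (rule naturally_maltsev_if_fibrewise_unital[OF E bp q])
    fix X Y f assume f: "f \<in> hom C X Y"
    have XY: "X \<in> Ob C" "Y \<in> Ob C" using hom_Ob[OF f] by auto
    note k = square_map_Ar[OF bp f]
    note s = f[unfolded hom_iff] k(1-3) XY P pb_pair_Ar[OF pb] q(1)[OF XY(1), unfolded hom_iff]
      q(1)[OF XY(2), unfolded hom_iff] arrow_simps
    have k': "square_map X Y f \<cdot> diag X = diag Y \<cdot> f"
      using k(6)[of "\<one> X" "\<one> X"] by (simp add: s diag_def[of X])
    let ?g = "fibre_pair Y (square_map X Y f \<cdot> fibre_pr1 X) (square_map X Y f \<cdot> fibre_pr2 X)"
    have g: "?g \<in> Ar C" "src C ?g = fibre_pairs X" "tgt C ?g = fibre_pairs Y"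
      "\<And>t. t \<in> Ar C \<Longrightarrow> tgt C t = fibre_pairs X \<Longrightarrow>
        ?g \<cdot> t = fibre_pair Y (square_map X Y f \<cdot> fibre_pr1 X \<cdot> t) (square_map X Y f \<cdot> fibre_pr2 X \<cdot> t)"
      using cmp_eq_cmp[OF k(5), of "fibre_pr1 X"] cmp_eq_cmp[OF k(5), of "fibre_pr2 X"]
      by (simp_all add: s)
    have gR: "?g \<cdot> ?R X = ?R Y \<cdot> square_map X Y f" "?g \<cdot> ?L X = ?L Y \<cdot> square_map X Y f"
      using cmp_eq_cmp[OF k', of "pr2 X X"] k(5) by (simp_all add: s g(4))
    have "f \<cdot> q X \<in> hom C (fibre_pairs X) Y" "q Y \<cdot> ?g \<in> hom C (fibre_pairs X) Y"
      using g by (simp_all add: s hom_iff)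
    moreover have "(f \<cdot> q X) \<cdot> ?R X = f \<cdot> pr1 X X"
      by (subst cmp_assoc_Ar) (simp_all only: q(2)[OF XY(1)], simp_all add: s)
    moreover have "(f \<cdot> q X) \<cdot> ?L X = f \<cdot> pr1 X X"
      by (subst cmp_assoc_Ar) (simp_all only: q(3)[OF XY(1)], simp_all add: s)
    moreover have "(q Y \<cdot> ?g) \<cdot> ?R X = f \<cdot> pr1 X X"
    proof -
      have "(q Y \<cdot> ?g) \<cdot> ?R X = q Y \<cdot> ?g \<cdot> ?R X" using g by (subst cmp_assoc_Ar) (simp_all add: s)
      also have "\<dots> = (q Y \<cdot> ?R Y) \<cdot> square_map X Y f"
        unfolding gR by (subst cmp_assoc_Ar) (simp_all add: s)
      finally show ?thesis using q(2)[OF XY(2)] k(4) by simp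
    qed
    moreover have "(q Y \<cdot> ?g) \<cdot> ?L X = f \<cdot> pr1 X X"
    proof -
      have "(q Y \<cdot> ?g) \<cdot> ?L X = q Y \<cdot> ?g \<cdot> ?L X" using g by (subst cmp_assoc_Ar) (simp_all add: s)
      also have "\<dots> = (q Y \<cdot> ?L Y) \<cdot> square_map X Y f"
        unfolding gR by (subst cmp_assoc_Ar) (simp_all add: s)
      finally show ?thesis using q(3)[OF XY(2)] k(4) by simp
    qed
    ultimately show "f \<cdot> q X = q Y \<cdot> ?g" using sol[OF f] by blast
  qed
qed

section \<open>From pregroupoid structures to the operation\<close>

text \<open>For the span of two copies of the morphism \<open>b X\<close> to the terminal object, the conditions on triples
  are void and every \<open>f\<close> is a morphism of spans over the identity of the terminal object. The
  canonical structures on these spans therefore form a natural operation.\<close>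

theorem naturally_maltsev_if_canonical_pregroupoids:
  assumes E: "has_split_epi_pullbacks" and fp: "has_finite_products"
    and "spans_have_canonical_pregroupoids"
  shows "naturally_maltsev"
proof -
  obtain T where T: "is_terminal T" and bp: "has_binary_products"
    using fp by (auto simp: has_finite_products_def)
  obtain p where can: "canonical_pregroupoids p"
    using assms(3) by (auto simp: spans_have_canonical_pregroupoids_def)
  define b where "b X = (THE t. t \<in> hom C X T)" for X
  have b: "b X \<in> hom C X T" if "X \<in> Ob C" for X
    unfolding b_def using theI'[of "\<lambda>t. t \<in> hom C X T"] T that by (auto simp: is_terminal_def)
  have Tu: "f = g" if "f \<in> hom C X T" "g \<in> hom C X T" for f g X
    using T hom_Ob[OF that(1)] that unfolding is_terminal_def by blast
  have bs: "is_span (b X) (b X)" "src C (b X) = X" "tgt C (b X) = T" if "X \<in> Ob C" for X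
    using terminal_span[OF T bp b[OF that]] b[OF that] by (auto simp: hom_def)
  have pg: "is_pregroupoid (b X) (b X) (p (b X) (b X))" if "X \<in> Ob C" for X
    using can bs(1)[OF that] by (simp add: canonical_pregroupoids_def)
  have bx: "b X \<cdot> x = b X \<cdot> y" if "x \<in> hom C S X" "y \<in> hom C S X" for S X x y
    using Tu cmp_hom[OF that(1) b] cmp_hom[OF that(2) b] hom_Ob[OF that(1)] by blast
  define M where "M x y z = p (b (tgt C x)) (b (tgt C x)) \<cdot> span_triple (b (tgt C x)) (b (tgt C x)) x y z"
    for x y z
  have Meq: "M x y z = p (b X) (b X) \<cdot> span_triple (b X) (b X) x y z" if "x \<in> hom C S X" for S X x y z
    using that by (simp add: M_def hom_iff)
  have "maltsev_operation C M"
  proof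
    show "has_binary_products" by (rule bp)
  next
    fix x y z S X assume h: "x \<in> hom C S X" "y \<in> hom C S X" "z \<in> hom C S X"
    have X: "X \<in> Ob C" using hom_Ob[OF h(1)] by simp
    note st = span_triple_props[OF E bs(1)[OF X], unfolded bs(2)[OF X], OF h bx[OF h(1,2)] bx[OF h(2,3)]]
    have pX: "p (b X) (b X) \<in> hom C (span_ob (b X) (b X)) X"
      using pregroupoidD(1)[OF pg[OF X]] bs(2)[OF X] by simp
    show "M x y z \<in> hom C S X"
      unfolding Meq[OF h(1)] by (rule cmp_hom[OF st(1) pX])
    show "M x y z \<cdot> t = M (x \<cdot> t) (y \<cdot> t) (z \<cdot> t)" if t: "t \<in> hom C R S" for t R
      unfolding Meq[OF h(1)] Meq[OF cmp_hom[OF t h(1)]] cmp_assoc[OF t st(1) pX] st(2)[OF t] ..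
    show "f \<cdot> M x y z = M (f \<cdot> x) (f \<cdot> y) (f \<cdot> z)" if f: "f \<in> hom C X Y" for f Y
    proof -
      have Y: "Y \<in> Ob C" using hom_Ob[OF f] by simp
      have i: "\<one> T \<in> hom C T T" using T ident_hom by (simp add: is_terminal_def)
      have e: "b Y \<cdot> f = \<one> T \<cdot> b X"
        using Tu cmp_hom[OF f b[OF Y]] cmp_hom[OF b[OF X] i] by blast
      have nat: "natural_pregroupoids p" using can by (simp add: canonical_pregroupoids_def)
      show ?thesis
        unfolding Meq[OF h(1)] Meq[OF cmp_hom[OF h(1) f]]
        using nat[unfolded natural_pregroupoids_def, rule_format, of "b X" "b X" "b Y" "b Y" f "\<one> T" "\<one> T" x S y z]
          bs[OF X] bs[OF Y] f i e h bx[OF h(1,2)] bx[OF h(2,3)] by simp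
    qed
  next
    fix x y S X assume h: "x \<in> hom C S X" "y \<in> hom C S X"
    have X: "X \<in> Ob C" using hom_Ob[OF h(1)] by simp
    show "M x y y = x" "M x x y = y"
      unfolding Meq[OF h(1)]
      by (rule pregroupoidD(4,5)[OF pg[OF X], unfolded bs(2)[OF X], OF h bx[OF h]])+
  qed
  then show ?thesis unfolding naturally_maltsev_iff_operation by blast
qed

end

section \<open>The equivalence of the six conditions\<close>

theorem corollary3:
  fixes C :: "('o, 'a) cat_data"
  assumes "category C"
    and "category.has_split_epi_pullbacks C"
    and "category.has_finite_products C"
  shows "(category.naturally_maltsev C \<longleftrightarrow> category.Grpd_RG_has_section C)
    \<and> (category.naturally_maltsev C \<longleftrightarrow> category.Cat_RG_has_section C)
    \<and> (category.naturally_maltsev C \<longleftrightarrow> category.relations_compatible_with_spans C)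
    \<and> (category.naturally_maltsev C \<longleftrightarrow> category.dikites_admissible C)
    \<and> (category.naturally_maltsev C \<longleftrightarrow> category.spans_have_canonical_pregroupoids C)"
proof -
  interpret category C by (rule assms(1))
  have bp: "has_binary_products" using assms(3) by (simp add: has_finite_products_def)
  have "Grpd_RG_has_section" "relations_compatible_with_spans" "spans_have_canonical_pregroupoids"
    if "naturally_maltsev"
    using that maltsev_operation.Grpd_section maltsev_operation.relations_compatible
      maltsev_operation.canonical_pregroupoids_exist assms(2)
    unfolding naturally_maltsev_iff_operation by blast+
  then show ?thesis
    using Cat_section_if_Grpd_section[OF assms(2)] naturally_maltsev_if_Cat_section[OF assms(2) bp]
      dikites_admissible_if_relations_compatible[OF assms(2)]
      naturally_maltsev_if_dikites_admissible[OF assms(2,3)]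
      naturally_maltsev_if_canonical_pregroupoids[OF assms(2,3)]
    by blast
qed

end
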